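(* Let $\Omega\subset\mathbb{R}^n$ be a bounded domain, let $p\ge 2$ and $2n<\alpha p<n+p$, and put $s=\alpha-n/p\in(0,1)$. Then the minimizer of the Rayleigh quotient $$\frac{\int_{\mathbb{R}^n}\int_{\mathbb{R}^n}\frac{|u(y)-u(x)|^p}{|y-x|^{\alpha p}}\,dx\,dy}{\int_{\mathbb{R}^n}|u(x)|^p\,dx}$$ is unique except that it may be multiplied by a constant: if $u,v\in W^{s,p}_0(\Omega)$, $u,v\not\equiv 0$, are both minimizers, then $u=Cv$ for some constant $C$.
   Context: $W^{s,p}_0(\Omega)$ is the closure of $C_0^\infty(\Omega)$ in the fractional Sobolev norm of $W^{s,p}(\Omega)$, given by $\|u\|^p=\iint \frac{|u(y)-u(x)|^p}{|y-x|^{n+sp}}\,dx\,dy+\int|u|^p\,dx$; note $n+sp=\alpha p$. Functions in $W^{s,p}_0(\Omega)$ are extended by zero to $\mathbb{R}^n$. Let $\lambda_1$ denote the infimum of the Rayleigh quotient over all $\phi\in C_0^\infty(\Omega)$, $\phi\not\equiv0$. A minimizer is a function $u\in W^{s,p}_0(\Omega)$, $u\not\equiv 0$, whose Rayleigh quotient equals $\lambda_1$. *)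

theory Defs
  imports "HOL-Analysis.Analysis"
begin

fun Ck :: "nat \<Rightarrow> ('a::euclidean_space \<Rightarrow> real) \<Rightarrow> bool" where
  "Ck 0 f \<longleftrightarrow> continuous_on UNIV f"
| "Ck (Suc k) f \<longleftrightarrow> f differentiable_on UNIV \<and>
     (\<forall>b\<in>Basis. Ck k (\<lambda>x. frechet_derivative f (at x) b))"

definition smooth_compact_support :: "'a::euclidean_space set \<Rightarrow> ('a \<Rightarrow> real) set" where
  "smooth_compact_support \<Omega> =
     {\<phi>. (\<forall>k. Ck k \<phi>) \<and> compact (closure {x. \<phi> x \<noteq> 0}) \<and> closure {x. \<phi> x \<noteq> 0} \<subseteq> \<Omega>}"

(* The integrals are taken in the extended nonnegative reals, so an infinite energy is recorded
   as infinity. On the diagonal the quotient is 0/0 = 0, which is a null set anyway. *)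
definition frac_energy ::
    "real \<Rightarrow> real \<Rightarrow> 'a::euclidean_space set \<Rightarrow> ('a \<Rightarrow> real) \<Rightarrow> ennreal" where
  "frac_energy p \<beta> S u =
     (\<integral>\<^sup>+y\<in>S. (\<integral>\<^sup>+x\<in>S. ennreal (\<bar>u y - u x\<bar> powr p / norm (y - x) powr \<beta>) \<partial>lborel) \<partial>lborel)"

definition Lp_mass :: "real \<Rightarrow> 'a::euclidean_space set \<Rightarrow> ('a \<Rightarrow> real) \<Rightarrow> ennreal" where
  "Lp_mass p S u = (\<integral>\<^sup>+x\<in>S. ennreal (\<bar>u x\<bar> powr p) \<partial>lborel)"

(* The p-th power of the norm of the fractional Sobolev space on \<Omega>:
   both variables of the double integral range over \<Omega>. *)
definition frac_sobolev_norm_pow ::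
    "real \<Rightarrow> real \<Rightarrow> 'a::euclidean_space set \<Rightarrow> ('a \<Rightarrow> real) \<Rightarrow> ennreal" where
  "frac_sobolev_norm_pow s p \<Omega> u =
     frac_energy p (real DIM('a) + s * p) \<Omega> u + Lp_mass p \<Omega> u"

(* Elements are Borel representatives on the whole space, extended by zero outside \<Omega>; two of
   them represent the same element of the space iff they agree almost everywhere. *)
definition frac_sobolev0 ::
    "real \<Rightarrow> real \<Rightarrow> 'a::euclidean_space set \<Rightarrow> ('a \<Rightarrow> real) set" where
  "frac_sobolev0 s p \<Omega> =
     {u. u \<in> borel_measurable borel \<and> (\<forall>x. x \<notin> \<Omega> \<longrightarrow> u x = 0) \<and>
         frac_sobolev_norm_pow s p \<Omega> u < \<infinity> \<and>
         (\<forall>\<epsilon>>0. \<exists>\<phi>\<in>smooth_compact_support \<Omega>.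
            frac_sobolev_norm_pow s p \<Omega> (\<lambda>x. u x - \<phi> x) < \<epsilon>)}"

definition rayleigh :: "real \<Rightarrow> real \<Rightarrow> ('a::euclidean_space \<Rightarrow> real) \<Rightarrow> ennreal" where
  "rayleigh \<alpha> p u = frac_energy p (\<alpha> * p) UNIV u / Lp_mass p UNIV u"

definition lambda1 :: "real \<Rightarrow> real \<Rightarrow> 'a::euclidean_space set \<Rightarrow> ennreal" where
  "lambda1 \<alpha> p \<Omega> =
     (INF \<phi> \<in> {\<phi> \<in> smooth_compact_support \<Omega>. \<exists>x. \<phi> x \<noteq> 0}. rayleigh \<alpha> p \<phi>)"

definition is_minimizer ::
    "real \<Rightarrow> real \<Rightarrow> real \<Rightarrow> 'a::euclidean_space set \<Rightarrow> ('a \<Rightarrow> real) \<Rightarrow> bool" where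
  "is_minimizer \<alpha> s p \<Omega> u \<longleftrightarrow>
     u \<in> frac_sobolev0 s p \<Omega> \<and> \<not> (AE x in lborel. u x = 0) \<and> rayleigh \<alpha> p u = lambda1 \<alpha> p \<Omega>"

end

theory Submission
  imports Defs "HOL-Probability.Probability_Measure"
begin

text \<open>
  For minimizers \<open>u\<close> and \<open>v\<close> consider \<open>w = (\<bar>u\<bar>\<^sup>p + \<bar>v\<bar>\<^sup>p)\<^sup>1\<^sup>/\<^sup>p\<close>. By Minkowski's inequality in the
  plane with the \<open>p\<close>-norm, \<open>\<bar>w(y) - w(x)\<bar>\<^sup>p \<le> \<bar>u(y) - u(x)\<bar>\<^sup>p + \<bar>v(y) - v(x)\<bar>\<^sup>p\<close>, with equality only if
  \<open>u(y) v(x) = u(x) v(y)\<close>. The masses add up exactly, so if the Rayleigh quotient of \<open>w\<close> is at least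
  \<open>\<lambda>\<^sub>1\<close>, equality holds almost everywhere and \<open>u\<close>, \<open>v\<close> are proportional.

  The space is a closure in the norm over \<open>\<Omega> \<times> \<Omega>\<close> only, whereas the quotient uses the energy over the
  whole space, so \<open>w\<close> is not approximated directly. Let \<open>\<zeta>\<^sub>k\<close> be built like \<open>w\<close>, but from test functions
  that approximate \<open>u\<close> and \<open>v\<close>, and truncate \<open>w\<close> to \<open>min w \<zeta>\<^sub>k\<close>, which has compact support in \<open>\<Omega>\<close>.
  If the approximation is fast enough, the energy densities of the truncations have an integrable
  majorant: on \<open>\<Omega> \<times> \<Omega>\<close> by summability of the approximation errors, and elsewhere by the density of \<open>w\<close>
  itself, because there one of the two values vanishes. Finally, a compactly supported function \<open>W\<close>
  is mollified; convolution with \<open>\<eta>\<close> decreases the energy by Jensen's inequality, and moves \<open>W\<close> in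
  \<open>L\<^sup>p\<close> by at most \<open>sup (\<eta>(h) \<bar>h\<bar>\<^sup>\<alpha>\<^sup>p)\<close> times the energy, which tends to zero since \<open>\<alpha>p > n\<close>.
\<close>

subsection \<open>The plane with the p-norm\<close>

text \<open>Convexity on the open half-line is \<open>powr_convex\<close>. At the endpoint 0 the
  claim reduces to r powr q \<le> r for r in [0,1], which is where q \<ge> 1 enters.\<close>

lemma powr_convex_nonneg:
  fixes x y q t :: real
  assumes q: "q \<ge> 1" and "x \<ge> 0" "y \<ge> 0" "0 \<le> t" "t \<le> 1"
  shows "(t * x + (1 - t) * y) powr q \<le> t * x powr q + (1 - t) * y powr q"
proof -
  have sc: "(r * z) powr q \<le> r * z powr q" if "0 \<le> r" "r \<le> 1" "0 \<le> z" for r z :: real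
  proof -
    have "r powr q \<le> r"
    proof (cases "r = 0")
      case False
      then show ?thesis using powr_mono'[of 1 q r] that q by simp
    qed (use q in simp)
    then show ?thesis using that by (simp add: powr_mult mult_right_mono)
  qed
  show ?thesis
  proof (cases "x = 0 \<or> y = 0")
    case True
    then show ?thesis
      using sc[of t x] sc[of "1 - t" y] assms by (auto simp: mult_nonneg_nonneg)
  next
    case False
    then have "convex_on {0<..} (\<lambda>x. x powr q)" "x \<in> {0<..}" "y \<in> {0<..}"
      using assms powr_convex[OF q] by auto
    from convex_onD[OF this(1), of "1 - t" x y] this(2,3) assms show ?thesis
      by (simp add: algebra_simps)
  qed
qed

text \<open>Write \<bar>z\<bar> powr p as a power of z^2 with exponent p/2 \<ge> 1. The square has
  the explicit convexity defect t(1-t)(x-y)^2, and this defect supplies the strictness.\<close>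

lemma abs_powr_convex_strict:
  fixes x y p t :: real
  assumes p: "p \<ge> 2" and t: "0 \<le> t" "t \<le> 1"
  shows "\<bar>t * x + (1 - t) * y\<bar> powr p \<le> t * \<bar>x\<bar> powr p + (1 - t) * \<bar>y\<bar> powr p"
    and "\<lbrakk>0 < t; t < 1; x \<noteq> y\<rbrakk> \<Longrightarrow>
      \<bar>t * x + (1 - t) * y\<bar> powr p < t * \<bar>x\<bar> powr p + (1 - t) * \<bar>y\<bar> powr p"
proof -
  have sq: "\<bar>z\<bar> powr p = (z\<^sup>2) powr (p / 2)" for z :: real
  proof -
    have "z\<^sup>2 = \<bar>z\<bar> powr 2"
      by (cases "z = 0") (simp_all add: powr_numeral)
    then show ?thesis by (simp only: powr_powr) simp
  qed
  have id: "(t * x + (1 - t) * y)\<^sup>2 = t * x\<^sup>2 + (1 - t) * y\<^sup>2 - t * (1 - t) * (x - y)\<^sup>2"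
    by (simp add: power2_eq_square algebra_simps)
  have cv: "(t * x\<^sup>2 + (1 - t) * y\<^sup>2) powr (p / 2) \<le> t * \<bar>x\<bar> powr p + (1 - t) * \<bar>y\<bar> powr p"
    unfolding sq by (rule powr_convex_nonneg) (use p t in auto)
  have "0 \<le> t * (1 - t) * (x - y)\<^sup>2"
    using t by simp
  then have "(t * x + (1 - t) * y)\<^sup>2 \<le> t * x\<^sup>2 + (1 - t) * y\<^sup>2"
    unfolding id by linarith
  then have "((t * x + (1 - t) * y)\<^sup>2) powr (p / 2) \<le> (t * x\<^sup>2 + (1 - t) * y\<^sup>2) powr (p / 2)"
    using p by (intro powr_mono2) auto
  with cv show "\<bar>t * x + (1 - t) * y\<bar> powr p \<le> t * \<bar>x\<bar> powr p + (1 - t) * \<bar>y\<bar> powr p"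
    unfolding sq[of "t * x + (1 - t) * y"] by linarith
  assume "0 < t" "t < 1" "x \<noteq> y"
  then have "0 < t * (1 - t) * (x - y)\<^sup>2"
    by simp
  then have "(t * x + (1 - t) * y)\<^sup>2 < t * x\<^sup>2 + (1 - t) * y\<^sup>2"
    unfolding id by linarith
  then have "((t * x + (1 - t) * y)\<^sup>2) powr (p / 2) < (t * x\<^sup>2 + (1 - t) * y\<^sup>2) powr (p / 2)"
    using p by (intro powr_less_mono2) auto
  with cv show "\<bar>t * x + (1 - t) * y\<bar> powr p < t * \<bar>x\<bar> powr p + (1 - t) * \<bar>y\<bar> powr p"
    unfolding sq[of "t * x + (1 - t) * y"] by linarith
qed

lemma convex_abs_powr: "p \<ge> 2 \<Longrightarrow> convex_on UNIV (\<lambda>x::real. \<bar>x\<bar> powr p)"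
  using abs_powr_convex_strict(1)[of p "1 - _"]
  by (intro convex_onI) auto

lemma abs_add_powr_le:
  fixes x y p :: real
  assumes "p \<ge> 2"
  shows "\<bar>x + y\<bar> powr p \<le> 2 powr p * (\<bar>x\<bar> powr p + \<bar>y\<bar> powr p)"
proof -
  have "\<bar>x + y\<bar> powr p = 2 powr p * \<bar>1/2 * x + (1 - 1/2) * y\<bar> powr p"
    by (simp flip: powr_mult abs_mult add_divide_distrib)
  also have "\<dots> \<le> 2 powr p * (1/2 * \<bar>x\<bar> powr p + (1 - 1/2) * \<bar>y\<bar> powr p)"
    using assms by (intro mult_left_mono abs_powr_convex_strict(1)) auto
  also have "\<dots> \<le> 2 powr p * (\<bar>x\<bar> powr p + \<bar>y\<bar> powr p)"
    by (intro mult_left_mono add_mono) auto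
  finally show ?thesis .
qed

definition pnorm2 :: "real \<Rightarrow> real \<Rightarrow> real \<Rightarrow> real" where
  "pnorm2 p a b = (\<bar>a\<bar> powr p + \<bar>b\<bar> powr p) powr (1 / p)"

lemma pnorm2_nonneg [simp]: "0 \<le> pnorm2 p a b"
  by (simp add: pnorm2_def)

lemma pnorm2_powr: "p > 0 \<Longrightarrow> pnorm2 p a b powr p = \<bar>a\<bar> powr p + \<bar>b\<bar> powr p"
  by (simp add: pnorm2_def powr_powr)

lemma pnorm2_eq_0 [simp]: "pnorm2 p a b = 0 \<longleftrightarrow> a = 0 \<and> b = 0"
proof -
  have "\<bar>a\<bar> powr p + \<bar>b\<bar> powr p = 0 \<longleftrightarrow> a = 0 \<and> b = 0"
    by (subst add_nonneg_eq_0_iff) auto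
  then show ?thesis by (simp add: pnorm2_def)
qed

lemma pnorm2_abs_minus: "pnorm2 p (- a) (- b) = pnorm2 p a b"
  by (simp add: pnorm2_def)

lemma continuous_pnorm2:
  assumes "p > 0"
  shows "continuous_on UNIV (\<lambda>z. pnorm2 p (fst z) (snd z))"
  unfolding pnorm2_def using assms
  by (intro continuous_on_powr' continuous_intros) (auto simp: add_nonneg_eq_0_iff)

text \<open>Minkowski's inequality by normalization: the sum divided by A + B is a convex
  combination, with weight t = A/(A + B), of two vectors of p-norm 1, and \<bar>.\<bar> powr p is
  convex in each coordinate. Strict convexity makes the vectors parallel in the case of
  equality.\<close>

lemma pnorm2_triangle:
  assumes p: "p \<ge> 2"
  shows "pnorm2 p (a + c) (b + d) \<le> pnorm2 p a b + pnorm2 p c d"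
    and "pnorm2 p (a + c) (b + d) = pnorm2 p a b + pnorm2 p c d \<Longrightarrow> a * d = b * c"
proof -
  define A where "A = pnorm2 p a b"
  define B where "B = pnorm2 p c d"
  define t where "t = A / (A + B)"
  have AB: "0 \<le> A" "0 \<le> B" by (auto simp: A_def B_def)
  have *: "pnorm2 p (a + c) (b + d) \<le> A + B \<and>
      (pnorm2 p (a + c) (b + d) = A + B \<longrightarrow> a * d = b * c)"
  proof (cases "A = 0 \<or> B = 0")
    case True
    then show ?thesis by (auto simp: A_def B_def)
  next
    case False
    with AB have pos: "0 < A" "0 < B" by auto
    then have t: "0 < t" "t < 1" "1 - t = B / (A + B)"
      by (auto simp: t_def field_simps)
    have rep: "(x + y) / (A + B) = t * (x / A) + (1 - t) * (y / B)" for x y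
    proof -
      have "t * (x / A) = x / (A + B)" "(1 - t) * (y / B) = y / (A + B)"
        using pos unfolding t(3) by (simp_all add: t_def)
      then show ?thesis by (simp add: add_divide_distrib)
    qed
    let ?R = "\<lambda>x y. t * \<bar>x / A\<bar> powr p + (1 - t) * \<bar>y / B\<bar> powr p"
    have le: "\<bar>(x + y) / (A + B)\<bar> powr p \<le> ?R x y" for x y
      unfolding rep using p t(1,2) by (intro abs_powr_convex_strict(1)) auto
    have less: "\<bar>(x + y) / (A + B)\<bar> powr p < ?R x y" if "x / A \<noteq> y / B" for x y
      unfolding rep using p t(1,2) that by (intro abs_powr_convex_strict(2)) auto
    have one: "\<bar>a / A\<bar> powr p + \<bar>b / A\<bar> powr p = 1" "\<bar>c / B\<bar> powr p + \<bar>d / B\<bar> powr p = 1"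
    proof -
      have "A powr p = \<bar>a\<bar> powr p + \<bar>b\<bar> powr p" "B powr p = \<bar>c\<bar> powr p + \<bar>d\<bar> powr p"
        using p by (simp_all add: A_def B_def pnorm2_powr)
      moreover have "A powr p \<noteq> 0" "B powr p \<noteq> 0"
        using pos by auto
      ultimately
      show "\<bar>a / A\<bar> powr p + \<bar>b / A\<bar> powr p = 1" "\<bar>c / B\<bar> powr p + \<bar>d / B\<bar> powr p = 1"
        using pos by (simp_all add: powr_divide abs_divide flip: add_divide_distrib)
    qed
    have "?R a c + ?R b d = t * (\<bar>a / A\<bar> powr p + \<bar>b / A\<bar> powr p) + (1 - t) * (\<bar>c / B\<bar> powr p + \<bar>d / B\<bar> powr p)"
      by (simp only: distrib_left add_ac)
    then have sum1: "?R a c + ?R b d = 1"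
      by (simp only: one) simp
    have N: "\<bar>(a + c) / (A + B)\<bar> powr p + \<bar>(b + d) / (A + B)\<bar> powr p =
        (pnorm2 p (a + c) (b + d) / (A + B)) powr p"
      using pos p by (simp add: powr_divide abs_divide pnorm2_powr flip: add_divide_distrib)
    have le1: "(pnorm2 p (a + c) (b + d) / (A + B)) powr p \<le> 1"
      using le[of a c] le[of b d] sum1 N by linarith
    have "pnorm2 p (a + c) (b + d) / (A + B) \<le> 1"
    proof (rule ccontr)
      assume "\<not> ?thesis"
      then have "1 powr p < (pnorm2 p (a + c) (b + d) / (A + B)) powr p"
        using p by (intro powr_less_mono2) auto
      with le1 show False by simp
    qed
    then have 1: "pnorm2 p (a + c) (b + d) \<le> A + B"
      using pos by (simp add: field_simps)
    \<comment> \<open>The two coordinate bounds add up to exactly 1, so equality of the norms forces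
      equality in both coordinates, and by strictness the normalized vectors coincide.\<close>
    {
      assume "pnorm2 p (a + c) (b + d) = A + B"
      then have "\<bar>(a + c) / (A + B)\<bar> powr p + \<bar>(b + d) / (A + B)\<bar> powr p = 1"
        using N pos by simp
      then have "a / A = c / B" "b / A = d / B"
        using le[of a c] le[of b d] less[of a c] less[of b d] sum1
        by force+
      then have "a = A * (c / B)" "b = A * (d / B)"
        using pos by (simp_all add: field_simps)
      then have "a * d = b * c"
        by (simp add: mult_ac)
    }
    with 1 show ?thesis by blast
  qed
  show "pnorm2 p (a + c) (b + d) \<le> pnorm2 p a b + pnorm2 p c d"
    "pnorm2 p (a + c) (b + d) = pnorm2 p a b + pnorm2 p c d \<Longrightarrow> a * d = b * c"
    using * by (auto simp: A_def B_def)
qed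

text \<open>This is the reverse triangle inequality raised to the power p. Applied to the values of
  \<open>u\<close> and \<open>v\<close> at two points, it compares energy densities, and its
  equality case carries the uniqueness proof.\<close>

lemma pnorm2_diff_powr:
  assumes p: "p \<ge> 2"
  shows "\<bar>pnorm2 p a b - pnorm2 p c d\<bar> powr p \<le> \<bar>a - c\<bar> powr p + \<bar>b - d\<bar> powr p"
    and "\<bar>pnorm2 p a b - pnorm2 p c d\<bar> powr p = \<bar>a - c\<bar> powr p + \<bar>b - d\<bar> powr p \<Longrightarrow> a * d = c * b"
proof -
  have sym: "pnorm2 p (c - a) (d - b) = pnorm2 p (a - c) (b - d)"
    using pnorm2_abs_minus[of p "a - c" "b - d"] by simp
  have le: "\<bar>pnorm2 p a b - pnorm2 p c d\<bar> \<le> pnorm2 p (a - c) (b - d)"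
    using pnorm2_triangle(1)[OF p, of "a - c" c "b - d" d]
      pnorm2_triangle(1)[OF p, of "c - a" a "d - b" b] sym by simp
  have pow: "pnorm2 p (a - c) (b - d) powr p = \<bar>a - c\<bar> powr p + \<bar>b - d\<bar> powr p"
    using p by (simp add: pnorm2_powr)
  show "\<bar>pnorm2 p a b - pnorm2 p c d\<bar> powr p \<le> \<bar>a - c\<bar> powr p + \<bar>b - d\<bar> powr p"
    unfolding pow[symmetric] using le p by (intro powr_mono2) auto
  assume eq: "\<bar>pnorm2 p a b - pnorm2 p c d\<bar> powr p = \<bar>a - c\<bar> powr p + \<bar>b - d\<bar> powr p"
  have "\<bar>pnorm2 p a b - pnorm2 p c d\<bar> = pnorm2 p (a - c) (b - d)"
  proof (rule ccontr)
    assume "\<not> ?thesis"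
    with le have "\<bar>pnorm2 p a b - pnorm2 p c d\<bar> powr p < pnorm2 p (a - c) (b - d) powr p"
      using p by (intro powr_less_mono2) auto
    with eq pow show False by simp
  qed
  \<comment> \<open>The sign of the difference of the two norms decides which of the two
    applications of Minkowski's inequality is sharp.\<close>
  then consider "pnorm2 p (a - c + c) (b - d + d) = pnorm2 p (a - c) (b - d) + pnorm2 p c d"
    | "pnorm2 p (c - a + a) (d - b + b) = pnorm2 p (c - a) (d - b) + pnorm2 p a b"
    using sym by (auto simp: abs_if split: if_splits)
  then show "a * d = c * b"
  proof cases
    case 1
    from pnorm2_triangle(2)[OF p this] show ?thesis by (simp add: algebra_simps)
  next
    case 2
    from pnorm2_triangle(2)[OF p this] show ?thesis by (simp add: algebra_simps)
  qed
qed

subsection \<open>Smooth functions and convolution\<close>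

text \<open>Uniqueness of the derivative lets any explicit derivative stand in for
  \<open>frechet_derivative\<close>.\<close>

lemma Ck_SucI:
  assumes "\<And>x. (f has_derivative D x) (at x)" and "\<And>b. b \<in> Basis \<Longrightarrow> Ck k (\<lambda>x. D x b)"
  shows "Ck (Suc k) f"
proof -
  have "D x = frechet_derivative f (at x)" for x
    using assms(1) by (rule frechet_derivative_at)
  with assms show ?thesis
    by (auto simp: differentiable_on_def intro: differentiableI has_derivative_at_withinI)
qed

lemma Ck_Suc_has_derivative:
  "Ck (Suc k) f \<Longrightarrow> (f has_derivative frechet_derivative f (at x)) (at x)"
  by (simp add: differentiable_on_def frechet_derivative_works)

lemma Ck_Suc_imp_Ck: "Ck (Suc k) f \<Longrightarrow> Ck k f"
proof (induction k arbitrary: f)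
  case 0
  then show ?case by (simp add: differentiable_imp_continuous_on)
next
  case (Suc k)
  then have "f differentiable_on UNIV"
    and "\<And>b. b \<in> Basis \<Longrightarrow> Ck (Suc k) (\<lambda>x. frechet_derivative f (at x) b)"
    unfolding Ck.simps(2)[of "Suc k"] by blast+
  with Suc.IH show ?case by simp
qed

lemma Ck_mono: "j \<le> k \<Longrightarrow> Ck k f \<Longrightarrow> Ck j f"
proof (induction k)
  case (Suc k)
  then show ?case by (cases "j = Suc k") (auto dest: Ck_Suc_imp_Ck simp del: Ck.simps)
qed simp

lemma Ck_imp_continuous: "Ck k f \<Longrightarrow> continuous_on UNIV f"
  by (cases k) (simp_all add: differentiable_imp_continuous_on)

lemma Ck_add: "Ck k f \<Longrightarrow> Ck k g \<Longrightarrow> Ck k (\<lambda>x. f x + g x)"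
proof (induction k arbitrary: f g)
  case 0
  then show ?case by (auto intro: continuous_intros)
next
  case (Suc k)
  from Suc.IH Suc.prems show ?case
    by (intro Ck_SucI[OF has_derivative_add[OF Ck_Suc_has_derivative[OF Suc.prems(1)]
            Ck_Suc_has_derivative[OF Suc.prems(2)]]]) auto
qed

lemma Ck_mult: "Ck k f \<Longrightarrow> Ck k g \<Longrightarrow> Ck k (\<lambda>x. f x * g x)"
proof (induction k arbitrary: f g)
  case 0
  then show ?case by (auto intro: continuous_intros)
next
  case (Suc k)
  then have "Ck k f" "Ck k g" by (blast intro: Ck_Suc_imp_Ck)+
  with Suc.IH Suc.prems show ?case
    by (intro Ck_SucI[OF has_derivative_mult[OF Ck_Suc_has_derivative[OF Suc.prems(1)]
            Ck_Suc_has_derivative[OF Suc.prems(2)]]] Ck_add) auto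
qed

lemma Ck_const: "Ck k (\<lambda>x. c)"
  by (induction k arbitrary: c) (auto intro: Ck_SucI[OF has_derivative_const])

lemma Ck_affine: "Ck k f \<Longrightarrow> Ck k (\<lambda>x. f (a + c *\<^sub>R x))"
proof (induction k arbitrary: f)
  case 0
  then show ?case
    by (auto intro!: continuous_intros continuous_on_compose2[of UNIV f])
next
  case (Suc k)
  let ?D = "\<lambda>x. frechet_derivative f (at (a + c *\<^sub>R x))"
  have lin: "linear (?D x)" for x
    using Ck_Suc_has_derivative[OF Suc.prems] has_derivative_linear by blast
  have "((\<lambda>x. f (a + c *\<^sub>R x)) has_derivative (\<lambda>h. ?D x (c *\<^sub>R h))) (at x)" for x
    by (rule has_derivative_compose[OF _ Ck_Suc_has_derivative[OF Suc.prems]])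
       (auto intro!: derivative_eq_intros)
  then show ?case
  proof (rule Ck_SucI)
    fix b :: 'a assume "b \<in> Basis"
    then have "Ck k (\<lambda>x. frechet_derivative f (at x) b)"
      using Suc.prems by simp
    from Ck_mult[OF Ck_const Suc.IH[OF this]] show "Ck k (\<lambda>x. ?D x (c *\<^sub>R b))"
      by (simp add: linear_scale[OF lin])
  qed
qed

section \<open>Convolution with a smooth kernel of compact support\<close>

definition conv :: "('a::euclidean_space \<Rightarrow> real) \<Rightarrow> ('a \<Rightarrow> real) \<Rightarrow> 'a \<Rightarrow> real" where
  "conv g W x = (\<integral>y. g (x - y) * W y \<partial>lborel)"

lemma bounded_of_compact_support:
  fixes g :: "'a::euclidean_space \<Rightarrow> real"
  assumes "continuous_on UNIV g" "compact K" "\<And>x. g x \<noteq> 0 \<Longrightarrow> x \<in> K"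
  obtains B where "B > 0" "\<And>x. \<bar>g x\<bar> \<le> B"
proof -
  have "bounded (g ` K)"
    using assms by (intro compact_imp_bounded compact_continuous_image) (auto intro: continuous_on_subset)
  then obtain B where "B > 0" "\<forall>z\<in>g ` K. norm z \<le> B"
    by (auto simp: bounded_pos)
  then have "\<bar>g x\<bar> \<le> B" for x
    using assms(3)[of x] by (cases "g x = 0") auto
  with that \<open>B > 0\<close> show ?thesis by blast
qed

lemma integrable_conv_integrand:
  fixes g W :: "'a::euclidean_space \<Rightarrow> real"
  assumes [measurable]: "g \<in> borel_measurable borel" and B: "\<And>x. \<bar>g x\<bar> \<le> B"
    and W: "integrable lborel W"
  shows "integrable lborel (\<lambda>y. g (x - y) * W y)"
proof (rule Bochner_Integration.integrable_bound)
  show "integrable lborel (\<lambda>y. B * W y)"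
    using W by simp
  have [measurable]: "W \<in> borel_measurable borel"
    using borel_measurable_integrable[OF W] by simp
  show "(\<lambda>y. g (x - y) * W y) \<in> borel_measurable lborel"
    by measurable
  show "AE y in lborel. norm (g (x - y) * W y) \<le> norm (B * W y)"
    by (intro AE_I2) (auto simp: abs_mult intro!: mult_right_mono order_trans[OF B])
qed

text \<open>Partial derivatives keep the supporting set \<open>K\<close>, so the induction on the
  order of smoothness of a convolution can use one fixed \<open>K\<close>.\<close>

lemma frechet_derivative_eq_0_outside:
  assumes "closed K" and "\<And>x. g x \<noteq> 0 \<Longrightarrow> x \<in> K" and "x \<notin> K"
  shows "frechet_derivative g (at x) b = 0"
proof -
  have "(g has_derivative (\<lambda>h. 0)) (at x)"
    by (rule has_derivative_transform_within_open[OF has_derivative_const[of 0], of "- K"])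
       (use assms in auto)
  then have "(\<lambda>h. 0) = frechet_derivative g (at x)"
    by (rule frechet_derivative_at)
  then show ?thesis by metis
qed

text \<open>Differentiation under the integral sign; the point x occurs only in the kernel. The
  derivative is written in coordinates so that its directional values are again convolutions, with
  the partial derivatives of \<open>g\<close>.\<close>

lemma conv_has_derivative:
  fixes g W :: "'a::euclidean_space \<Rightarrow> real"
  assumes g: "Ck 1 g" and K: "compact K" "\<And>x. g x \<noteq> 0 \<Longrightarrow> x \<in> K" and W: "integrable lborel W"
  shows "(conv g W has_derivative
      (\<lambda>h. \<Sum>b\<in>Basis. (h \<bullet> b) * conv (\<lambda>z. frechet_derivative g (at z) b) W x)) (at x)"
    (is "(_ has_derivative ?D) _")
proof -
  define d where "d b z = frechet_derivative g (at z) b" for b z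
  have der: "(g has_derivative frechet_derivative g (at z)) (at z)" for z
    using g by (intro Ck_Suc_has_derivative[of 0]) simp
  have cg: "continuous_on UNIV g"
    using g by (rule Ck_imp_continuous)
  then have [measurable]: "g \<in> borel_measurable borel"
    by (rule borel_measurable_continuous_onI)
  obtain B where B: "\<And>x. \<bar>g x\<bar> \<le> B"
    using bounded_of_compact_support[OF cg K] by blast
  have cd: "continuous_on UNIV (d b)" if "b \<in> Basis" for b
    using g that by (simp add: d_def)
  then have md [measurable]: "d b \<in> borel_measurable borel" if "b \<in> Basis" for b
    using that by (intro borel_measurable_continuous_onI)
  have "\<exists>B. \<forall>x. \<bar>d b x\<bar> \<le> B" if "b \<in> Basis" for b
  proof -
    have "d b x \<noteq> 0 \<Longrightarrow> x \<in> K" for x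
      using frechet_derivative_eq_0_outside[of K g x b] K by (auto simp: d_def compact_imp_closed)
    then show ?thesis
      using bounded_of_compact_support[OF cd[OF that] K(1)] by blast
  qed
  then obtain L where L: "\<And>b x. b \<in> Basis \<Longrightarrow> \<bar>d b x\<bar> \<le> L b"
    by metis
  have L0: "0 \<le> (\<Sum>b\<in>Basis. L b)"
    by (intro sum_nonneg) (use L abs_ge_zero order_trans in blast)
  have Deq: "frechet_derivative g (at z) h = (\<Sum>b\<in>Basis. (h \<bullet> b) * d b z)" for z h
  proof -
    have lin: "linear (frechet_derivative g (at z))"
      using der has_derivative_linear by blast
    have "frechet_derivative g (at z) h = frechet_derivative g (at z) (\<Sum>b\<in>Basis. (h \<bullet> b) *\<^sub>R b)"
      by (simp add: euclidean_representation)
    also have "\<dots> = (\<Sum>b\<in>Basis. (h \<bullet> b) * d b z)"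
      by (simp add: linear_sum[OF lin] linear_scale[OF lin] d_def)
    finally show ?thesis .
  qed
  have Dle: "\<bar>frechet_derivative g (at z) h\<bar> \<le> (\<Sum>b\<in>Basis. L b) * norm h" for z h
  proof -
    have "\<bar>\<Sum>b\<in>Basis. (h \<bullet> b) * d b z\<bar> \<le> (\<Sum>b\<in>Basis. norm h * L b)"
      by (rule order_trans[OF sum_abs], intro sum_mono)
         (auto simp: abs_mult intro!: mult_mono L Basis_le_norm)
    then show ?thesis by (simp add: Deq sum_distrib_left sum_distrib_right mult.commute)
  qed
  \<comment> \<open>The mean value inequality gives a global Lipschitz bound. Together with
    \<open>Dle\<close> it bounds the difference quotient remainder uniformly in the
    increment.\<close>
  have lip: "\<bar>g (z + h) - g z\<bar> \<le> (\<Sum>b\<in>Basis. L b) * norm h" for z h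
  proof -
    have "norm (g (z + h) - g z) \<le> (\<Sum>b\<in>Basis. L b) * norm (z + h - z)"
      by (rule differentiable_bound[of UNIV g "\<lambda>z. frechet_derivative g (at z)"])
         (use der Dle L0 in \<open>auto intro!: onorm_le\<close>)
    then show ?thesis by simp
  qed
  \<comment> \<open>\<open>F\<close> is the integrand of the normalized remainder. It tends to 0
    pointwise and is dominated by a multiple of \<bar>W y\<bar>; dominated convergence is then
    applied along sequences of increments.\<close>
  define F where "F y h = (g (x - y + h) - g (x - y) - frechet_derivative g (at (x - y)) h) / norm h * W y" for y h
  have [measurable]: "W \<in> borel_measurable borel"
    using borel_measurable_integrable[OF W] by simp
  have Fint: "(conv g W (x + h) - conv g W x - ?D h) / norm h = (\<integral>y. F y h \<partial>lborel)" for h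
  proof -
    have *: "x - y + h = x + h - y" for y by simp
    have i1: "integrable lborel (\<lambda>y. g (x + h - y) * W y)" "integrable lborel (\<lambda>y. g (x - y) * W y)"
      by (intro integrable_conv_integrand[OF _ B W]; simp)+
    have i2: "integrable lborel (\<lambda>y. d b (x - y) * W y)" if "b \<in> Basis" for b
      using that by (intro integrable_conv_integrand[OF _ L W]) auto
    then have i3: "integrable lborel (\<lambda>y. \<Sum>b\<in>Basis. (h \<bullet> b) * (d b (x - y) * W y))"
      by (intro Bochner_Integration.integrable_sum) auto
    have "?D h = (\<integral>y. (\<Sum>b\<in>Basis. (h \<bullet> b) * (d b (x - y) * W y)) \<partial>lborel)"
      using i2 by (subst Bochner_Integration.integral_sum) (auto simp: conv_def d_def)
    then have "conv g W (x + h) - conv g W x - ?D h =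
        (\<integral>y. g (x + h - y) * W y - g (x - y) * W y - (\<Sum>b\<in>Basis. (h \<bullet> b) * (d b (x - y) * W y)) \<partial>lborel)"
      using i1 i3 by (simp add: conv_def)
    then show ?thesis
      unfolding F_def * Deq
      by (simp add: sum_distrib_right algebra_simps diff_divide_distrib flip: integral_divide_zero)
         (simp add: sum_distrib_right sum_distrib_left algebra_simps diff_divide_distrib sum_divide_distrib)
  qed
  have "(\<lambda>h. (\<integral>y. F y h \<partial>lborel)) \<midarrow>0\<rightarrow> 0"
    unfolding tendsto_at_iff_sequentially
  proof (intro allI impI)
    fix X :: "nat \<Rightarrow> 'a"
    assume X: "\<forall>i. X i \<in> UNIV - {0}" "X \<longlonglongrightarrow> 0"
    have "(\<lambda>i. \<integral>y. F y (X i) \<partial>lborel) \<longlonglongrightarrow> (\<integral>y. 0 \<partial>(lborel::'a measure))"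
    proof (rule integral_dominated_convergence[where w = "\<lambda>y. 2 * (\<Sum>b\<in>Basis. L b) * \<bar>W y\<bar>"])
      show "(\<lambda>y. F y (X i)) \<in> borel_measurable lborel" for i
        unfolding F_def Deq by measurable
      show "integrable lborel (\<lambda>y. 2 * (\<Sum>b\<in>Basis. L b) * \<bar>W y\<bar>)"
        using W by simp
      show "AE y in lborel. (\<lambda>i. F y (X i)) \<longlonglongrightarrow> 0"
      proof (rule AE_I2)
        fix y
        have "(\<lambda>h. norm (g (x - y + h) - g (x - y) - frechet_derivative g (at (x - y)) h) / norm h) \<midarrow>0\<rightarrow> 0"
          using der[of "x - y"] by (simp add: has_derivative_at)
        then have "(\<lambda>i. norm (g (x - y + X i) - g (x - y) - frechet_derivative g (at (x - y)) (X i)) / norm (X i)) \<longlonglongrightarrow> 0"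
          using X unfolding tendsto_at_iff_sequentially by (simp add: comp_def)
        then have "(\<lambda>i. norm (g (x - y + X i) - g (x - y) - frechet_derivative g (at (x - y)) (X i)) / norm (X i) * \<bar>W y\<bar>) \<longlonglongrightarrow> 0"
          by (rule tendsto_mult_left_zero)
        then show "(\<lambda>i. F y (X i)) \<longlonglongrightarrow> 0"
          by (intro tendsto_norm_zero_cancel[where f = "\<lambda>i. F y (X i)"]) (simp add: F_def abs_mult)
      qed
      show "AE y in lborel. norm (F y (X i)) \<le> 2 * (\<Sum>b\<in>Basis. L b) * \<bar>W y\<bar>" for i
      proof (rule AE_I2)
        fix y
        have "\<bar>g (x - y + X i) - g (x - y) - frechet_derivative g (at (x - y)) (X i)\<bar>
          \<le> 2 * (\<Sum>b\<in>Basis. L b) * norm (X i)"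
          using lip[of "x - y" "X i"] Dle[of "x - y" "X i"] by linarith
        moreover have "norm (X i) > 0" using X(1) by simp
        ultimately have "\<bar>g (x - y + X i) - g (x - y) - frechet_derivative g (at (x - y)) (X i)\<bar> / norm (X i)
          \<le> 2 * (\<Sum>b\<in>Basis. L b)"
          by (simp add: field_simps)
        then have "\<bar>g (x - y + X i) - g (x - y) - frechet_derivative g (at (x - y)) (X i)\<bar> / norm (X i) * \<bar>W y\<bar>
          \<le> 2 * (\<Sum>b\<in>Basis. L b) * \<bar>W y\<bar>"
          by (rule mult_right_mono) simp
        then show "norm (F y (X i)) \<le> 2 * (\<Sum>b\<in>Basis. L b) * \<bar>W y\<bar>"
          by (simp add: F_def abs_mult)
      qed
    qed simp
    then show "((\<lambda>h. \<integral>y. F y h \<partial>lborel) \<circ> X) \<longlonglongrightarrow> 0"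
      by (simp add: comp_def)
  qed
  then have "(\<lambda>h. norm (\<integral>y. F y h \<partial>lborel)) \<midarrow>0\<rightarrow> 0"
    by (rule tendsto_norm_zero)
  then have "(\<lambda>h. norm (conv g W (x + h) - conv g W x - ?D h) / norm h) \<midarrow>0\<rightarrow> 0"
    by (simp flip: Fint)
  moreover have "bounded_linear ?D"
    by (intro bounded_linear_sum bounded_linear_mult_const bounded_linear_inner_left)
  ultimately show ?thesis
    by (simp add: has_derivative_at)
qed

lemma conv_continuous:
  fixes g W :: "'a::euclidean_space \<Rightarrow> real"
  assumes g: "continuous_on UNIV g" and K: "compact K" "\<And>x. g x \<noteq> 0 \<Longrightarrow> x \<in> K"
    and W: "integrable lborel W"
  shows "continuous_on UNIV (conv g W)"
proof (rule continuous_on_sequentiallyI)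
  fix X :: "nat \<Rightarrow> 'a" and x
  assume X: "X \<longlonglongrightarrow> x"
  obtain B where B: "\<And>x. \<bar>g x\<bar> \<le> B"
    using bounded_of_compact_support[OF g K] by blast
  have [measurable]: "W \<in> borel_measurable borel" "g \<in> borel_measurable borel"
    using borel_measurable_integrable[OF W] borel_measurable_continuous_onI[OF g] by simp_all
  show "(\<lambda>n. conv g W (X n)) \<longlonglongrightarrow> conv g W x"
    unfolding conv_def
  proof (rule integral_dominated_convergence[where w = "\<lambda>y. B * \<bar>W y\<bar>"])
    show "AE y in lborel. (\<lambda>i. g (X i - y) * W y) \<longlonglongrightarrow> g (x - y) * W y"
      using X g by (intro AE_I2 tendsto_mult_right continuous_on_tendsto_compose[of UNIV g] tendsto_diff) auto
  qed (use W B in \<open>auto simp: abs_mult mult_right_mono\<close>)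
qed

text \<open>Induction on k with the kernel arbitrary: all derivatives fall on \<open>g\<close>, so
  \<open>W\<close> only has to be integrable.\<close>

lemma Ck_conv:
  fixes g W :: "'a::euclidean_space \<Rightarrow> real"
  assumes "compact K" and "integrable lborel W"
  shows "Ck k g \<Longrightarrow> (\<And>x. g x \<noteq> 0 \<Longrightarrow> x \<in> K) \<Longrightarrow> Ck k (conv g W)"
proof (induction k arbitrary: g)
  case 0
  then show ?case using assms by (simp add: conv_continuous)
next
  case (Suc k)
  have "Ck 1 g"
    using Ck_mono[OF _ Suc.prems(1), of 1] by simp
  show ?case
  proof (rule Ck_SucI[OF conv_has_derivative[OF \<open>Ck 1 g\<close> assms(1) Suc.prems(2) assms(2)]])
    fix b :: 'a assume b: "b \<in> Basis"
    have "Ck k (conv (\<lambda>z. frechet_derivative g (at z) b) W)"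
    proof (rule Suc.IH)
      show "Ck k (\<lambda>z. frechet_derivative g (at z) b)"
        using Suc.prems b by simp
      show "x \<in> K" if "frechet_derivative g (at x) b \<noteq> 0" for x
        using frechet_derivative_eq_0_outside[of K g x b] Suc.prems(2) assms(1) that
        by (auto simp: compact_imp_closed)
    qed
    \<comment> \<open>In a basis direction orthonormality leaves a single summand.\<close>
    moreover have "(\<Sum>c\<in>Basis. (b \<bullet> c) * conv (\<lambda>z. frechet_derivative g (at z) c) W x)
        = conv (\<lambda>z. frechet_derivative g (at z) b) W x" for x
      using b by (simp add: inner_Basis if_distrib[of "\<lambda>t. t * _"] cong: if_cong)
    ultimately show "Ck k (\<lambda>x. \<Sum>c\<in>Basis. (b \<bullet> c) * conv (\<lambda>z. frechet_derivative g (at z) c) W x)"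
      by simp
  qed
qed

subsection \<open>Mollifiers\<close>

text \<open>The margin serves twice: it keeps the support of a mollified function inside \<Omega>,
  and it keeps the kernel away from its singularity when one point lies in \<open>K\<close> and the
  other outside \<Omega>.\<close>

lemma compact_in_open_margin:
  fixes K :: "'a::euclidean_space set"
  assumes "compact K" "open \<Omega>" "K \<subseteq> \<Omega>"
  obtains d where "d > 0" "\<And>x y. x \<in> K \<Longrightarrow> y \<notin> \<Omega> \<Longrightarrow> d \<le> norm (x - y)"
proof (cases "K = {}")
  case True
  then show ?thesis using that[of 1] by auto
next
  case False
  obtain e where e: "e > 0" "(\<Union>x\<in>K. ball x e) \<subseteq> \<Omega>"
    using compact_subset_open_imp_ball_epsilon_subset[OF assms(1-3)] by blast
  show ?thesis
    by (rule that[of e]) (use e in \<open>force simp: subset_eq dist_norm\<close>)+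
qed

lemma integrable_of_compact_support:
  fixes f :: "'a::euclidean_space \<Rightarrow> real"
  assumes [measurable]: "f \<in> borel_measurable borel" and K: "compact K" "\<And>x. f x \<noteq> 0 \<Longrightarrow> x \<in> K"
    and B: "\<And>x. \<bar>f x\<bar> \<le> B"
  shows "integrable lborel f"
proof (rule Bochner_Integration.integrable_bound)
  show "integrable lborel (\<lambda>x. B * indicator K x)"
    using K(1) emeasure_compact_finite[OF K(1)]
    by (intro integrable_mult_right) (auto simp: integrable_indicator_iff borel_compact)
  have "0 \<le> B" using B[of undefined] by linarith
  then show "AE x in lborel. norm (f x) \<le> norm (B * indicator K x)"
    using K(2) B by (intro AE_I2) (auto simp: indicator_def)
qed simp

lemma ennreal_le_suminf: "(T :: nat \<Rightarrow> ennreal) k \<le> (\<Sum>k. T k)"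
  using sum_le_suminf[of T "{k}"] by simp

text \<open>\<open>E\<close> is the energy for mollification errors and 1 for the errors of
  approximation by test functions.\<close>

lemma suminf_geometric_half_less_top:
  assumes "\<And>n. f n \<le> ennreal ((1/2)^n) * E" and "E < top"
  shows "(\<Sum>n. f n) < top"
proof -
  have "(\<Sum>n. f n) \<le> (\<Sum>n. ennreal ((1/2)^n) * E)"
    using assms(1) by (intro suminf_le) auto
  also have "\<dots> = ennreal (\<Sum>n. (1/2)^n) * E"
    by (subst ennreal_suminf_multc) (simp add: suminf_ennreal2 summable_geometric)
  finally show ?thesis
    by (rule le_less_trans) (use assms(2) in \<open>simp add: ennreal_mult_less_top\<close>)
qed

lemma nn_integral_lborel_translate:
  fixes f :: "'a::euclidean_space \<Rightarrow> ennreal"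
  assumes [measurable]: "f \<in> borel_measurable borel"
  shows "(\<integral>\<^sup>+x. f (x - h) \<partial>lborel) = (\<integral>\<^sup>+x. f x \<partial>lborel)"
proof -
  have "(\<integral>\<^sup>+x. f x \<partial>lborel) = (\<integral>\<^sup>+x. f x \<partial>distr lborel borel ((+) (- h)))"
    by (simp only: lborel_distr_plus)
  also have "\<dots> = (\<integral>\<^sup>+x. f (x - h) \<partial>lborel)"
    by (subst nn_integral_distr) auto
  finally show ?thesis by simp
qed

lemma lborel_distr_reflect: "distr lborel borel (\<lambda>z. x - z) = (lborel :: 'a::euclidean_space measure)"
  by (subst (2) lborel_affine[of "-1" x]) (auto simp: density_1)

lemma nn_integral_lborel_reflect:
  fixes f :: "'a::euclidean_space \<Rightarrow> ennreal"
  assumes [measurable]: "f \<in> borel_measurable borel"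
  shows "(\<integral>\<^sup>+z. f (x - z) \<partial>lborel) = (\<integral>\<^sup>+z. f z \<partial>lborel)"
proof -
  have "(\<integral>\<^sup>+z. f z \<partial>lborel) = (\<integral>\<^sup>+z. f z \<partial>distr lborel borel (\<lambda>z. x - z))"
    by (simp only: lborel_distr_reflect)
  then show ?thesis
    by (simp add: nn_integral_distr)
qed

text \<open>Reflection moves the point x from the kernel to \<open>W\<close>, so that a mollifier
  can be read as a probability density averaging translates of \<open>W\<close>.\<close>

lemma conv_eq:
  assumes [measurable]: "g \<in> borel_measurable borel" "W \<in> borel_measurable borel"
  shows "conv g W x = (\<integral>h. g h * W (x - h) \<partial>lborel)"
proof -
  have "conv g W x = (\<integral>z. g (x - z) * W z \<partial>distr lborel borel (\<lambda>z. x - z))"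
    by (simp only: lborel_distr_reflect conv_def)
  then show ?thesis
    by (simp add: integral_distr)
qed

text \<open>The set where \<open>f\<close> does not vanish is open, and a nonempty open set is not
  negligible.\<close>

lemma continuous_AE_0_imp_0:
  fixes f :: "'a::euclidean_space \<Rightarrow> real"
  assumes "continuous_on UNIV f" and "AE x in lborel. f x = 0"
  shows "f x = 0"
proof -
  have op: "open {x. f x \<noteq> 0}"
    using assms(1) by (intro open_Collect_neq continuous_intros) auto
  have "{x. f x \<noteq> 0} \<in> null_sets lborel"
    using assms(2) op AE_iff_null_sets[of "{x. f x \<noteq> 0}" lborel] by (simp add: borel_open)
  then have "negligible {x. f x \<noteq> 0}"
    by (simp add: negligible_iff_null_sets null_sets_completionI)
  with op have "{x. f x \<noteq> 0} = {}"
    using open_not_negligible by blast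
  then show ?thesis by auto
qed

text \<open>Rescaled squares of any nonzero test function serve as mollifiers, so no explicit bump is needed.\<close>
lemma mollifier_exists:
  fixes \<phi> :: "'a::euclidean_space \<Rightarrow> real"
  assumes \<phi>: "\<And>k. Ck k \<phi>" and K: "compact K" "\<And>x. \<phi> x \<noteq> 0 \<Longrightarrow> x \<in> K" and x0: "\<phi> x0 \<noteq> 0"
    and \<beta>: "real DIM('a) < \<beta>" and \<epsilon>: "\<epsilon> > 0"
  obtains \<eta> :: "'a \<Rightarrow> real" where "\<And>k. Ck k \<eta>" "\<And>h. 0 \<le> \<eta> h" "\<And>h. \<eta> h \<noteq> 0 \<Longrightarrow> norm h \<le> \<epsilon>"
    "integrable lborel \<eta>" "(\<integral>h. \<eta> h \<partial>lborel) = 1" "\<And>h. \<eta> h * norm h powr \<beta> \<le> \<epsilon>"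
proof -
  let ?n = "real DIM('a)"
  have c: "continuous_on UNIV \<phi>"
    using \<phi>[of 0] by simp
  then have [measurable]: "\<phi> \<in> borel_measurable borel"
    by (rule borel_measurable_continuous_onI)
  obtain B where B: "B > 0" "\<And>x. \<bar>\<phi> x\<bar> \<le> B"
    using bounded_of_compact_support[OF c K] by blast
  have int: "integrable lborel (\<lambda>x. (\<phi> x)\<^sup>2)"
  proof (rule integrable_of_compact_support[OF _ K(1)])
    show "\<bar>(\<phi> x)\<^sup>2\<bar> \<le> B\<^sup>2" for x
      using power_mono[OF B(2)[of x], of 2] by simp
  qed (use K(2) in auto)
  define I where "I = (\<integral>x. (\<phi> x)\<^sup>2 \<partial>lborel)"
  have "I \<noteq> 0"
  proof
    assume "I = 0"
    then have "AE x in lborel. (\<phi> x)\<^sup>2 = 0"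
      using int unfolding I_def by (subst (asm) integral_nonneg_eq_0_iff_AE) auto
    then have "\<phi> x0 = 0"
      by (intro continuous_AE_0_imp_0 c) simp
    with x0 show False by simp
  qed
  moreover have "I \<ge> 0"
    unfolding I_def by simp
  ultimately have I: "I > 0" by simp
  obtain R' where R': "\<forall>x\<in>K. dist x0 x \<le> R'"
    using compact_imp_bounded[OF K(1)] bounded_any_center[of K x0] by blast
  define R where "R = max R' 1"
  have R: "R > 0" "\<And>x. x \<in> K \<Longrightarrow> dist x0 x \<le> R"
    using R' by (force simp: R_def)+
  \<comment> \<open>After scaling by j the mollifier is at most j^n B^2 / I and is supported in
    radius R / j. The product with norm h powr \<beta> is thus at most the expression here, which
    tends to 0 because n < \<beta>.\<close>
  have "((\<lambda>j. B\<^sup>2 / I * R powr \<beta> * j powr (?n - \<beta>)) \<longlongrightarrow> B\<^sup>2 / I * R powr \<beta> * 0) at_top"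
    using \<beta> by (intro tendsto_intros tendsto_neg_powr filterlim_ident) auto
  then have "\<forall>\<^sub>F j in at_top. B\<^sup>2 / I * R powr \<beta> * j powr (?n - \<beta>) < \<epsilon>"
    using \<epsilon> by (intro order_tendstoD) auto
  then have "\<forall>\<^sub>F j in at_top. B\<^sup>2 / I * R powr \<beta> * j powr (?n - \<beta>) < \<epsilon> \<and> j > 0 \<and> j \<ge> R / \<epsilon>"
    by (intro eventually_conj eventually_gt_at_top eventually_ge_at_top)
  then obtain j where j: "B\<^sup>2 / I * R powr \<beta> * j powr (?n - \<beta>) < \<epsilon>" "j > 0" "j \<ge> R / \<epsilon>"
    using eventually_happens'[OF trivial_limit_at_top_linorder] by blast
  \<comment> \<open>Squaring gives nonnegativity, centring at \<open>x0\<close> puts the support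
    around the origin, and the factor j^n / I makes the integral 1.\<close>
  define \<eta> where "\<eta> h = j ^ DIM('a) / I * (\<phi> (x0 + j *\<^sub>R h))\<^sup>2" for h
  have "Ck k \<eta>" for k
    unfolding \<eta>_def power2_eq_square by (intro Ck_mult Ck_const Ck_affine \<phi>)
  moreover have nonneg: "0 \<le> \<eta> h" for h
    unfolding \<eta>_def using I j by simp
  moreover have supp: "norm h \<le> R / j" if "\<eta> h \<noteq> 0" for h
  proof -
    have "x0 + j *\<^sub>R h \<in> K"
      using that by (intro K(2)) (auto simp: \<eta>_def)
    from R(2)[OF this] have "j * norm h \<le> R"
      using j by (simp add: dist_norm)
    then show ?thesis using j by (simp add: field_simps)
  qed
  moreover have "R / j \<le> \<epsilon>"
    using j \<epsilon> R by (simp add: field_simps)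
  moreover have "has_bochner_integral lborel \<eta> 1"
  proof -
    have "has_bochner_integral lborel (\<lambda>x. (\<phi> x)\<^sup>2) I"
      using int by (simp add: has_bochner_integral_iff I_def)
    then have "has_bochner_integral (density (distr lborel borel (\<lambda>x. x0 + j *\<^sub>R x)) (\<lambda>_. ennreal (\<bar>j\<bar>^DIM('a)))) (\<lambda>x. (\<phi> x)\<^sup>2) I"
      using lborel_affine[of j x0] j by simp
    then have "has_bochner_integral lborel (\<lambda>h. j ^ DIM('a) * (\<phi> (x0 + j *\<^sub>R h))\<^sup>2) I"
      using j
      by (simp add: has_bochner_integral_iff integrable_density integral_density integrable_distr_eq integral_distr)
    from has_bochner_integral_mult_right[OF this, of "1 / I"] show ?thesis
      using I by (simp add: \<eta>_def[abs_def])
  qed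
  moreover have "\<eta> h * norm h powr \<beta> \<le> \<epsilon>" for h
  proof (cases "\<eta> h = 0")
    case False
    have "norm h powr \<beta> \<le> (R / j) powr \<beta>"
      using supp[OF False] \<beta> by (intro powr_mono2) auto
    moreover have "(\<phi> (x0 + j *\<^sub>R h))\<^sup>2 \<le> B\<^sup>2"
      using power_mono[OF B(2)[of "x0 + j *\<^sub>R h"], of 2] by simp
    then have "\<eta> h \<le> j ^ DIM('a) / I * B\<^sup>2"
      unfolding \<eta>_def using I j by (intro mult_left_mono) auto
    ultimately have "\<eta> h * norm h powr \<beta> \<le> (j ^ DIM('a) / I * B\<^sup>2) * (R / j) powr \<beta>"
      by (intro mult_mono) (use nonneg I j in auto)
    also have "\<dots> = B\<^sup>2 / I * R powr \<beta> * j powr (?n - \<beta>)"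
      using R(1) j(2) by (simp add: powr_divide powr_diff powr_realpow)
    finally show ?thesis using j(1) by linarith
  qed (use \<epsilon> in simp)
  ultimately show ?thesis
    using that[of \<eta>] by (meson has_bochner_integral_iff order_trans)
qed

text \<open>Jensen's inequality for the probability measure with density \<eta>. Boundedness of
  \<open>f\<close> provides integrability, and the result is stated in \<open>ennreal\<close> so
  that Tonelli's theorem can be applied to it.\<close>

lemma abs_powr_integral_le:
  fixes f \<eta> :: "'a::euclidean_space \<Rightarrow> real"
  assumes p: "p \<ge> 2" and [measurable]: "f \<in> borel_measurable borel" "\<eta> \<in> borel_measurable borel"
    and B: "\<And>x. \<bar>f x\<bar> \<le> B"
    and \<eta>: "\<And>h. 0 \<le> \<eta> h" "integrable lborel \<eta>" "(\<integral>h. \<eta> h \<partial>lborel) = 1"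
  shows "ennreal (\<bar>\<integral>h. \<eta> h * f h \<partial>lborel\<bar> powr p) \<le> (\<integral>\<^sup>+h. ennreal (\<eta> h * \<bar>f h\<bar> powr p) \<partial>lborel)"
proof -
  define M where "M = density lborel (\<lambda>h. ennreal (\<eta> h))"
  have "(\<integral>\<^sup>+h. ennreal (\<eta> h) \<partial>lborel) = 1"
    using \<eta> by (simp add: nn_integral_eq_integral)
  then interpret M: prob_space M
    by (intro prob_spaceI) (simp add: M_def emeasure_density)
  have bd: "integrable M g" if [measurable]: "g \<in> borel_measurable borel" and "\<And>x. \<bar>g x\<bar> \<le> C" for g :: "'a \<Rightarrow> real" and C
    by (rule M.integrable_const_bound[of _ C]) (use that in \<open>auto simp: M_def\<close>)
  have "\<bar>M.expectation f\<bar> powr p \<le> M.expectation (\<lambda>x. \<bar>f x\<bar> powr p)"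
  proof (rule M.jensens_inequality[where I = UNIV])
    show "integrable M f" by (rule bd[OF _ B]) simp
    show "integrable M (\<lambda>x. \<bar>f x\<bar> powr p)"
      by (rule bd[of _ "B powr p"]) (use p B in \<open>auto intro!: powr_mono2\<close>)
  qed (use convex_abs_powr[OF p] in auto)
  then have "\<bar>\<integral>h. \<eta> h * f h \<partial>lborel\<bar> powr p \<le> (\<integral>h. \<eta> h * \<bar>f h\<bar> powr p \<partial>lborel)"
    using \<eta>(1) by (simp add: M_def integral_density)
  moreover have "integrable lborel (\<lambda>h. \<eta> h * \<bar>f h\<bar> powr p)"
  proof -
    have "integrable M (\<lambda>x. \<bar>f x\<bar> powr p)"
      by (rule bd[of _ "B powr p"]) (use p B in \<open>auto intro!: powr_mono2\<close>)
    then show ?thesis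
      using \<eta>(1) by (simp add: M_def integrable_density)
  qed
  ultimately show ?thesis
    using \<eta>(1) by (subst nn_integral_eq_integral) (auto intro: ennreal_leI)
qed

text \<open>The sum of the p-th powers has finite integral, so it is finite almost everywhere and
  its terms tend to 0. Convergence holds along the whole sequence, without passing to a
  subsequence.\<close>

lemma AE_tendsto_0_of_suminf_powr:
  fixes f :: "nat \<Rightarrow> 'a \<Rightarrow> real"
  assumes [measurable]: "\<And>k. f k \<in> borel_measurable M" and p: "p > 0"
    and fin: "(\<Sum>k. \<integral>\<^sup>+x. ennreal (\<bar>f k x\<bar> powr p) \<partial>M) \<noteq> \<infinity>"
  shows "AE x in M. (\<lambda>k. f k x) \<longlonglongrightarrow> 0"
proof -
  have "(\<integral>\<^sup>+x. (\<Sum>k. ennreal (\<bar>f k x\<bar> powr p)) \<partial>M) \<noteq> \<infinity>"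
    using fin by (subst nn_integral_suminf) auto
  then have "AE x in M. (\<Sum>k. ennreal (\<bar>f k x\<bar> powr p)) \<noteq> \<infinity>"
    by (intro nn_integral_PInf_AE) auto
  then show ?thesis
  proof (rule AE_mp, intro AE_I2 impI)
    fix x assume "(\<Sum>k. ennreal (\<bar>f k x\<bar> powr p)) \<noteq> \<infinity>"
    then have "summable (\<lambda>k. \<bar>f k x\<bar> powr p)"
      by (intro summable_suminf_not_top) auto
    then have "(\<lambda>k. \<bar>f k x\<bar> powr p) \<longlonglongrightarrow> 0"
      by (rule summable_LIMSEQ_zero)
    then have "(\<lambda>k. (\<bar>f k x\<bar> powr p) powr (1 / p)) \<longlonglongrightarrow> 0 powr (1 / p)"
      using p by (intro tendsto_powr') auto
    then have "(\<lambda>k. \<bar>f k x\<bar>) \<longlonglongrightarrow> 0"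
      using p by (simp add: powr_powr)
    then show "(\<lambda>k. f k x) \<longlonglongrightarrow> 0"
      by (simp add: tendsto_rabs_zero_iff)
  qed
qed

subsection \<open>Energy and mass under mollification\<close>

lemma frac_energy_UNIV:
  "frac_energy p \<beta> UNIV u =
    (\<integral>\<^sup>+y. (\<integral>\<^sup>+x. ennreal (\<bar>u y - u x\<bar> powr p / norm (y - x) powr \<beta>) \<partial>lborel) \<partial>lborel)"
  by (simp add: frac_energy_def)

lemma Lp_mass_UNIV: "Lp_mass p UNIV u = (\<integral>\<^sup>+x. ennreal (\<bar>u x\<bar> powr p) \<partial>lborel)"
  by (simp add: Lp_mass_def)

lemma Lp_mass_eq_0D:
  assumes [measurable]: "u \<in> borel_measurable borel" and 0: "Lp_mass p UNIV u = 0"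
  shows "AE x in lborel. u x = 0"
proof -
  from 0 have "AE x in lborel. ennreal (\<bar>u x\<bar> powr p) = 0"
    unfolding Lp_mass_UNIV by (subst (asm) nn_integral_0_iff_AE) auto
  then show ?thesis
    by (rule AE_mp) (simp add: ennreal_eq_0_iff)
qed

lemma borel_measurable_conv:
  assumes [measurable]: "g \<in> borel_measurable borel" "W \<in> borel_measurable borel"
  shows "conv g W \<in> borel_measurable borel"
  unfolding conv_def[abs_def] by measurable

context
  fixes p B :: real and W \<eta> :: "'a::euclidean_space \<Rightarrow> real"
  assumes p: "p \<ge> 2" and W [measurable]: "W \<in> borel_measurable borel" and B: "\<And>x. \<bar>W x\<bar> \<le> B"
    and \<eta>m [measurable]: "\<eta> \<in> borel_measurable borel"
    and \<eta>: "\<And>h. 0 \<le> \<eta> h" "integrable lborel \<eta>" "(\<integral>h. \<eta> h \<partial>lborel) = 1"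
begin

lemma integrable_mollifier_mult:
  "integrable lborel (\<lambda>h. \<eta> h * W (x - h))"
proof (rule Bochner_Integration.integrable_bound)
  show "integrable lborel (\<lambda>h. \<eta> h * B)"
    using \<eta> by simp
  have "\<bar>\<eta> h * W (x - h)\<bar> \<le> \<eta> h * B" for h
    unfolding abs_mult using \<eta>(1)[of h] B[of "x - h"] by (simp add: mult_left_mono)
  then show "AE h in lborel. norm (\<eta> h * W (x - h)) \<le> norm (\<eta> h * B)"
    by (intro AE_I2) (auto intro: order_trans[OF _ abs_ge_self])
qed simp

lemma nn_integral_mollifier: "(\<integral>\<^sup>+h. ennreal (\<eta> h) \<partial>lborel) = 1"
  using \<eta> by (simp add: nn_integral_eq_integral)

text \<open>Jensen's inequality bounds the density of the convolution by an average of translated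
  densities of \<open>W\<close>. After Tonelli's theorem every translate has the same energy, and
  the weights integrate to 1.\<close>

lemma frac_energy_conv_le: "frac_energy p \<beta> UNIV (conv \<eta> W) \<le> frac_energy p \<beta> UNIV W"
proof -
  define G where "G y x = ennreal (\<bar>W y - W x\<bar> powr p / norm (y - x) powr \<beta>)" for y x
  have [measurable]: "(\<lambda>z. G (fst z) (snd z)) \<in> borel_measurable (borel \<Otimes>\<^sub>M borel)"
    unfolding G_def by measurable
  have le: "ennreal (\<bar>conv \<eta> W y - conv \<eta> W x\<bar> powr p / norm (y - x) powr \<beta>)
      \<le> (\<integral>\<^sup>+h. ennreal (\<eta> h) * G (y - h) (x - h) \<partial>lborel)" for x y
  proof -
    have "conv \<eta> W y - conv \<eta> W x = (\<integral>h. \<eta> h * (W (y - h) - W (x - h)) \<partial>lborel)"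
      using integrable_mollifier_mult by (simp add: conv_eq right_diff_distrib)
    moreover have "ennreal (\<bar>\<integral>h. \<eta> h * (W (y - h) - W (x - h)) \<partial>lborel\<bar> powr p)
        \<le> (\<integral>\<^sup>+h. ennreal (\<eta> h * \<bar>W (y - h) - W (x - h)\<bar> powr p) \<partial>lborel)"
    proof (rule abs_powr_integral_le[OF p _ _ _ \<eta>, where B = "2 * B"])
      show "\<bar>W (y - h) - W (x - h)\<bar> \<le> 2 * B" for h
        using B[of "y - h"] B[of "x - h"] by linarith
    qed simp_all
    ultimately have "ennreal (\<bar>conv \<eta> W y - conv \<eta> W x\<bar> powr p)
        \<le> (\<integral>\<^sup>+h. ennreal (\<eta> h * \<bar>W (y - h) - W (x - h)\<bar> powr p) \<partial>lborel)"
      by simp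
    then have "ennreal (1 / norm (y - x) powr \<beta>) * ennreal (\<bar>conv \<eta> W y - conv \<eta> W x\<bar> powr p)
        \<le> ennreal (1 / norm (y - x) powr \<beta>) * (\<integral>\<^sup>+h. ennreal (\<eta> h * \<bar>W (y - h) - W (x - h)\<bar> powr p) \<partial>lborel)"
      by (rule mult_left_mono) simp
    \<comment> \<open>The factor 1 / norm (y - x) powr \<beta> can be absorbed because a common
      shift of both points leaves their difference unchanged.\<close>
    also have "\<dots> = (\<integral>\<^sup>+h. ennreal (\<eta> h) * G (y - h) (x - h) \<partial>lborel)"
      using \<eta>(1) by (subst nn_integral_cmult[symmetric]) (auto simp: G_def simp flip: ennreal_mult intro!: nn_integral_cong)
    finally show ?thesis
      by (simp flip: ennreal_mult)
  qed
  have "frac_energy p \<beta> UNIV (conv \<eta> W)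
      \<le> (\<integral>\<^sup>+y. (\<integral>\<^sup>+x. (\<integral>\<^sup>+h. ennreal (\<eta> h) * G (y - h) (x - h) \<partial>lborel) \<partial>lborel) \<partial>lborel)"
    unfolding frac_energy_UNIV by (intro nn_integral_mono le)
  also have "\<dots> = (\<integral>\<^sup>+y. (\<integral>\<^sup>+h. (\<integral>\<^sup>+x. ennreal (\<eta> h) * G (y - h) (x - h) \<partial>lborel) \<partial>lborel) \<partial>lborel)"
    by (intro nn_integral_cong lborel_pair.Fubini') (simp add: G_def)
  also have "\<dots> = (\<integral>\<^sup>+h. (\<integral>\<^sup>+y. (\<integral>\<^sup>+x. ennreal (\<eta> h) * G (y - h) (x - h) \<partial>lborel) \<partial>lborel) \<partial>lborel)"
    by (intro lborel_pair.Fubini') (simp add: G_def)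
  also have "\<dots> = (\<integral>\<^sup>+h. ennreal (\<eta> h) * frac_energy p \<beta> UNIV W \<partial>lborel)"
  proof (intro nn_integral_cong)
    fix h
    have m: "G y \<in> borel_measurable borel" for y
      unfolding G_def by measurable
    have "(\<integral>\<^sup>+y. (\<integral>\<^sup>+x. ennreal (\<eta> h) * G (y - h) (x - h) \<partial>lborel) \<partial>lborel)
        = (\<integral>\<^sup>+y. ennreal (\<eta> h) * (\<integral>\<^sup>+x. G (y - h) x \<partial>lborel) \<partial>lborel)"
      using m by (simp add: nn_integral_cmult nn_integral_lborel_translate)
    also have "\<dots> = ennreal (\<eta> h) * (\<integral>\<^sup>+y. (\<integral>\<^sup>+x. G (y - h) x \<partial>lborel) \<partial>lborel)"
      by (rule nn_integral_cmult) (simp add: G_def)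
    also have "(\<integral>\<^sup>+y. (\<integral>\<^sup>+x. G (y - h) x \<partial>lborel) \<partial>lborel) = frac_energy p \<beta> UNIV W"
      by (subst nn_integral_lborel_translate[where f = "\<lambda>y. \<integral>\<^sup>+x. G y x \<partial>lborel"])
         (simp_all add: G_def[abs_def] frac_energy_UNIV)
    finally show "(\<integral>\<^sup>+y. (\<integral>\<^sup>+x. ennreal (\<eta> h) * G (y - h) (x - h) \<partial>lborel) \<partial>lborel)
        = ennreal (\<eta> h) * frac_energy p \<beta> UNIV W" .
  qed
  also have "\<dots> = frac_energy p \<beta> UNIV W"
    by (simp add: nn_integral_multc nn_integral_mollifier)
  finally show ?thesis .
qed

text \<open>The error is the \<eta>-average of W(x-h) - W(x). After Jensen's inequality, the bound
  on \<eta> replaces the weight \<eta>(h) by \<epsilon> / norm h powr \<beta>, which is the kernel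
  of the energy.\<close>

lemma Lp_mass_conv_diff_le:
  assumes \<epsilon>: "\<And>h. \<eta> h * norm h powr \<beta> \<le> \<epsilon>"
  shows "Lp_mass p UNIV (\<lambda>x. conv \<eta> W x - W x) \<le> ennreal \<epsilon> * frac_energy p \<beta> UNIV W"
proof -
  have "0 \<le> \<epsilon>" using \<epsilon>[of 0] \<eta>(1)[of 0] by (meson mult_nonneg_nonneg order_trans powr_ge_zero)
  have le: "ennreal (\<bar>conv \<eta> W x - W x\<bar> powr p)
      \<le> ennreal \<epsilon> * (\<integral>\<^sup>+z. ennreal (\<bar>W x - W z\<bar> powr p / norm (x - z) powr \<beta>) \<partial>lborel)" for x
  proof -
    have "conv \<eta> W x - W x = (\<integral>h. \<eta> h * W (x - h) \<partial>lborel) - (\<integral>h. \<eta> h * W x \<partial>lborel)"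
      using \<eta> by (simp add: conv_eq)
    also have "\<dots> = (\<integral>h. \<eta> h * (W (x - h) - W x) \<partial>lborel)"
      using integrable_mollifier_mult[of x] \<eta> by (simp add: right_diff_distrib)
    finally have "ennreal (\<bar>conv \<eta> W x - W x\<bar> powr p) = ennreal (\<bar>\<integral>h. \<eta> h * (W (x - h) - W x) \<partial>lborel\<bar> powr p)"
      by simp
    also have "\<dots> \<le> (\<integral>\<^sup>+h. ennreal (\<eta> h * \<bar>W (x - h) - W x\<bar> powr p) \<partial>lborel)"
    proof (rule abs_powr_integral_le[OF p _ _ _ \<eta>, where B = "2 * B"])
      show "\<bar>W (x - h) - W x\<bar> \<le> 2 * B" for h
        using B[of "x - h"] B[of x] by linarith
    qed simp_all
    also have "\<dots> \<le> (\<integral>\<^sup>+h. ennreal \<epsilon> * ennreal (\<bar>W x - W (x - h)\<bar> powr p / norm h powr \<beta>) \<partial>lborel)"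
    proof (intro nn_integral_mono)
      fix h :: 'a
      show "ennreal (\<eta> h * \<bar>W (x - h) - W x\<bar> powr p)
          \<le> ennreal \<epsilon> * ennreal (\<bar>W x - W (x - h)\<bar> powr p / norm h powr \<beta>)"
      \<comment> \<open>At h = 0 the kernel bound says nothing, but the difference of the values of
        \<open>W\<close> is 0 there.\<close>
      proof (cases "h = 0")
        case False
        have "\<eta> h * \<bar>W (x - h) - W x\<bar> powr p
            = (\<eta> h * norm h powr \<beta>) * (\<bar>W x - W (x - h)\<bar> powr p / norm h powr \<beta>)"
          using False by (simp add: abs_minus_commute)
        also have "\<dots> \<le> \<epsilon> * (\<bar>W x - W (x - h)\<bar> powr p / norm h powr \<beta>)"
          by (intro mult_right_mono \<epsilon>) simp
        finally show ?thesis
          using \<open>0 \<le> \<epsilon>\<close> by (simp flip: ennreal_mult add: ennreal_leI)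
      qed simp
    qed
    \<comment> \<open>Writing h as x - (x - h) prepares the substitution z = x - h.\<close>
    also have "\<dots> = ennreal \<epsilon> * (\<integral>\<^sup>+h. ennreal (\<bar>W x - W (x - h)\<bar> powr p / norm (x - (x - h)) powr \<beta>) \<partial>lborel)"
      by (subst nn_integral_cmult) auto
    also have "(\<integral>\<^sup>+h. ennreal (\<bar>W x - W (x - h)\<bar> powr p / norm (x - (x - h)) powr \<beta>) \<partial>lborel)
        = (\<integral>\<^sup>+z. ennreal (\<bar>W x - W z\<bar> powr p / norm (x - z) powr \<beta>) \<partial>lborel)"
      by (rule nn_integral_lborel_reflect[where f = "\<lambda>z. ennreal (\<bar>W x - W z\<bar> powr p / norm (x - z) powr \<beta>)"]) measurable
    finally show ?thesis .
  qed
  have "Lp_mass p UNIV (\<lambda>x. conv \<eta> W x - W x)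
     \<le> (\<integral>\<^sup>+x. ennreal \<epsilon> * (\<integral>\<^sup>+z. ennreal (\<bar>W x - W z\<bar> powr p / norm (x - z) powr \<beta>) \<partial>lborel) \<partial>lborel)"
    unfolding Lp_mass_UNIV by (intro nn_integral_mono le)
  also have "\<dots> = ennreal \<epsilon> * frac_energy p \<beta> UNIV W"
    unfolding frac_energy_UNIV by (rule nn_integral_cmult) measurable
  finally show ?thesis .
qed

end

section \<open>The inequality with \<open>lambda1\<close> for bounded functions of compact
  support\<close>

text \<open>Fatou's lemma with a factor, later \<open>lambda1\<close>. The factor must be finite
  because multiplication by \<open>top\<close> is not continuous at 0.\<close>

lemma mult_Lp_mass_le_liminf:
  fixes c :: ennreal
  assumes c: "c < top" and p: "p > 0" and [measurable]: "\<And>n. V n \<in> borel_measurable borel"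
    and lim: "AE x in lborel. (\<lambda>n. V n x) \<longlonglongrightarrow> W x"
  shows "c * Lp_mass p UNIV W \<le> liminf (\<lambda>n. c * Lp_mass p UNIV (V n))"
proof -
  have Vm: "(\<lambda>x. ennreal (\<bar>V n x\<bar> powr p)) \<in> borel_measurable lborel" for n
    by measurable
  have lim': "AE x in lborel. liminf (\<lambda>n. ennreal (\<bar>V n x\<bar> powr p)) = ennreal (\<bar>W x\<bar> powr p)"
    using lim
  proof eventually_elim
    case (elim x)
    then have "(\<lambda>n. ennreal (\<bar>V n x\<bar> powr p)) \<longlonglongrightarrow> ennreal (\<bar>W x\<bar> powr p)"
      using p by (intro tendsto_ennrealI tendsto_powr' tendsto_rabs tendsto_const) auto
    then show ?case by (simp add: lim_imp_Liminf)
  qed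
  have "Lp_mass p UNIV W = (\<integral>\<^sup>+x. liminf (\<lambda>n. ennreal (\<bar>V n x\<bar> powr p)) \<partial>lborel)"
    unfolding Lp_mass_UNIV using lim' by (intro nn_integral_cong_AE) (auto elim: eventually_mono)
  also have "\<dots> \<le> liminf (\<lambda>n. Lp_mass p UNIV (V n))"
    unfolding Lp_mass_UNIV by (rule nn_integral_liminf[OF Vm])
  finally have "c * Lp_mass p UNIV W \<le> c * liminf (\<lambda>n. Lp_mass p UNIV (V n))"
    by (rule mult_left_mono) simp
  also have "\<dots> = liminf (\<lambda>n. c * Lp_mass p UNIV (V n))"
    using c by (intro Liminf_compose_continuous_mono[symmetric, where f = "(*) c"])
      (auto simp: mono_def intro!: mult_left_mono ennreal_continuous_on_cmult continuous_on_id)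
  finally show ?thesis .
qed

text \<open>The form without division also covers the zero function, which is excluded from the
  infimum.\<close>

lemma lambda1_mult_Lp_mass_le:
  assumes "\<phi> \<in> smooth_compact_support \<Omega>"
  shows "lambda1 \<alpha> p \<Omega> * Lp_mass p UNIV \<phi> \<le> frac_energy p (\<alpha> * p) UNIV \<phi>"
proof (cases "\<exists>x. \<phi> x \<noteq> 0")
  case True
  let ?M = "Lp_mass p UNIV \<phi>" and ?E = "frac_energy p (\<alpha> * p) UNIV \<phi>"
  have "lambda1 \<alpha> p \<Omega> \<le> ?E / ?M"
    unfolding lambda1_def rayleigh_def[symmetric] using assms True by (intro INF_lower) auto
  then have "lambda1 \<alpha> p \<Omega> * ?M \<le> ?E / ?M * ?M"
    by (rule mult_right_mono) simp
  \<comment> \<open>For zero or infinite mass the left side is 0 in \<open>ennreal\<close>, hence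
    only an inequality.\<close>
  also have "?E / ?M * ?M \<le> ?E"
  proof (cases "?M = 0 \<or> ?M = top")
    case False
    then show ?thesis
      by (simp add: ennreal_divide_times less_top)
  qed (auto simp: divide_ennreal_def)
  finally show ?thesis .
qed (simp add: Lp_mass_UNIV)

text \<open>Mollifications of \<open>W\<close> are test functions whose energy is at most that of
  \<open>W\<close>. They converge almost everywhere, so Fatou's lemma transfers the inequality. The
  test function \<phi> only serves to build the mollifiers.\<close>

lemma lambda1_mult_Lp_mass_le_of_compact_support:
  fixes W :: "'a::euclidean_space \<Rightarrow> real"
  assumes p: "p \<ge> 2" and \<beta>: "real DIM('a) < \<alpha> * p" and \<Omega>: "open \<Omega>"
    and \<phi>: "\<phi> \<in> smooth_compact_support \<Omega>" "\<phi> x0 \<noteq> 0"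
    and W [measurable]: "W \<in> borel_measurable borel" and B: "\<And>x. \<bar>W x\<bar> \<le> B"
    and K: "compact K" "K \<subseteq> \<Omega>" "\<And>x. W x \<noteq> 0 \<Longrightarrow> x \<in> K"
    and fin: "lambda1 \<alpha> p \<Omega> < top"
  shows "lambda1 \<alpha> p \<Omega> * Lp_mass p UNIV W \<le> frac_energy p (\<alpha> * p) UNIV W"
proof (cases "frac_energy p (\<alpha> * p) UNIV W = top")
  case False
  define E where "E = frac_energy p (\<alpha> * p) UNIV W"
  have E: "E < top" using False by (simp add: E_def less_top)
  obtain e where e: "e > 0" "\<And>x y. x \<in> K \<Longrightarrow> y \<notin> \<Omega> \<Longrightarrow> e \<le> norm (x - y)"
    using compact_in_open_margin[OF K(1) \<Omega> K(2)] by blast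
  \<comment> \<open>Half the margin, so that even the closed neighbourhood of \<open>K\<close> of
    radius \<open>d\<close> lies in \<Omega>.\<close>
  define d where "d = e / 2"
  have d: "d > 0" "{x + y |x y. x \<in> K \<and> y \<in> cball 0 d} \<subseteq> \<Omega>"
    using e by (force simp: d_def)+
  have Wint: "integrable lborel W"
    by (rule integrable_of_compact_support[OF W K(1,3) B])
  have ex: "\<forall>n::nat. \<exists>\<eta>::'a \<Rightarrow> real. (\<forall>k. Ck k \<eta>) \<and> (\<forall>h. 0 \<le> \<eta> h) \<and> (\<forall>h. \<eta> h \<noteq> 0 \<longrightarrow> norm h \<le> d) \<and>
      integrable lborel \<eta> \<and> (\<integral>h. \<eta> h \<partial>lborel) = 1 \<and> (\<forall>h. \<eta> h * norm h powr (\<alpha> * p) \<le> (1/2)^n)"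
  proof (rule allI)
    fix n :: nat
    have \<phi>': "\<And>k. Ck k \<phi>" "compact (closure {x. \<phi> x \<noteq> 0})" "\<And>x. \<phi> x \<noteq> 0 \<Longrightarrow> x \<in> closure {x. \<phi> x \<noteq> 0}"
      using \<phi>(1) closure_subset[of "{x. \<phi> x \<noteq> 0}"] by (auto simp: smooth_compact_support_def)
    \<comment> \<open>One parameter controls the support radius and the kernel bound. Afterwards
      only the radius \<open>d\<close> and the rate (1/2)^n are kept: convergence comes from the
      kernel bound, not from shrinking supports.\<close>
    have "0 < min d ((1/2)^n)" using d by simp
    from mollifier_exists[OF \<phi>' \<phi>(2) \<beta> this] obtain \<eta> :: "'a \<Rightarrow> real" where
      "\<And>k. Ck k \<eta>" "\<And>h. 0 \<le> \<eta> h" "\<And>h. \<eta> h \<noteq> 0 \<Longrightarrow> norm h \<le> min d ((1/2)^n)"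
      "integrable lborel \<eta>" "(\<integral>h. \<eta> h \<partial>lborel) = 1" "\<And>h. \<eta> h * norm h powr (\<alpha> * p) \<le> min d ((1/2)^n)"
      by metis
    note \<eta> = this
    show "\<exists>\<eta>::'a \<Rightarrow> real. (\<forall>k. Ck k \<eta>) \<and> (\<forall>h. 0 \<le> \<eta> h) \<and> (\<forall>h. \<eta> h \<noteq> 0 \<longrightarrow> norm h \<le> d) \<and>
      integrable lborel \<eta> \<and> (\<integral>h. \<eta> h \<partial>lborel) = 1 \<and> (\<forall>h. \<eta> h * norm h powr (\<alpha> * p) \<le> (1/2)^n)"
      by (rule exI[of _ \<eta>]) (use \<eta> in auto)
  qed
  obtain \<eta> :: "nat \<Rightarrow> 'a \<Rightarrow> real" where \<eta>: "\<And>n k. Ck k (\<eta> n)" "\<And>n h. 0 \<le> \<eta> n h"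
    "\<And>n h. \<eta> n h \<noteq> 0 \<Longrightarrow> norm h \<le> d" "\<And>n. integrable lborel (\<eta> n)" "\<And>n. (\<integral>h. \<eta> n h \<partial>lborel) = 1"
    "\<And>n h. \<eta> n h * norm h powr (\<alpha> * p) \<le> (1/2)^n"
    using choice[OF ex] by metis
  have [measurable]: "\<eta> n \<in> borel_measurable borel" for n
    using \<eta>(1)[where k=0] by (intro borel_measurable_continuous_onI) simp
  define V where "V n = conv (\<eta> n) W" for n
  have [measurable]: "V n \<in> borel_measurable borel" for n
    unfolding V_def by (intro borel_measurable_conv) auto
  have V: "V n \<in> smooth_compact_support \<Omega>" for n
  proof -
    let ?K = "{x + y |x y. x \<in> K \<and> y \<in> cball 0 d}"
    have "compact ?K"
      by (intro compact_sums K(1) compact_cball)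
    have "x \<in> ?K" if "V n x \<noteq> 0" for x
    proof (rule ccontr)
      assume *: "x \<notin> ?K"
      have "\<eta> n (x - y) * W y = 0" for y
      proof (rule ccontr)
        assume "\<eta> n (x - y) * W y \<noteq> 0"
        then have "y \<in> K" "x - y \<in> cball 0 d" using K(3) \<eta>(3) by auto
        then have "y + (x - y) \<in> ?K" by blast
        moreover have "y + (x - y) = x" by simp
        ultimately show False using * by metis
      qed
      then have "V n x = 0" unfolding V_def conv_def by (simp only: Bochner_Integration.integral_zero)
      with that show False by simp
    qed
    then have sub: "{x. V n x \<noteq> 0} \<subseteq> ?K"
      by blast
    then have "closure {x. V n x \<noteq> 0} \<subseteq> ?K"
      using \<open>compact ?K\<close> by (intro closure_minimal compact_imp_closed)
    moreover have "compact (closure {x. V n x \<noteq> 0})"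
      unfolding compact_closure by (rule bounded_subset[OF compact_imp_bounded[OF \<open>compact ?K\<close>] sub])
    moreover have "Ck k (V n)" for k
      unfolding V_def by (rule Ck_conv[of "cball 0 d"]) (use Wint \<eta> in auto)
    ultimately show ?thesis
      using d(2) by (simp only: smooth_compact_support_def mem_Collect_eq) blast
  qed
  have EV: "frac_energy p (\<alpha> * p) UNIV (V n) \<le> E" for n
    unfolding V_def E_def by (rule frac_energy_conv_le[OF p W B _ \<eta>(2,4,5)]) simp
  have MV: "Lp_mass p UNIV (\<lambda>x. V n x - W x) \<le> ennreal ((1/2)^n) * E" for n
    unfolding V_def E_def by (rule Lp_mass_conv_diff_le[OF p W B _ \<eta>(2,4,5,6)]) simp
  have "AE x in lborel. (\<lambda>n. V n x - W x) \<longlonglongrightarrow> 0"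
  proof (rule AE_tendsto_0_of_suminf_powr)
    have "(\<Sum>n. \<integral>\<^sup>+x. ennreal (\<bar>V n x - W x\<bar> powr p) \<partial>lborel) < top"
      using MV E by (intro suminf_geometric_half_less_top) (auto simp: Lp_mass_UNIV)
    then show "(\<Sum>n. \<integral>\<^sup>+x. ennreal (\<bar>V n x - W x\<bar> powr p) \<partial>lborel) \<noteq> \<infinity>"
      by simp
  qed (use p in auto)
  then have lim: "AE x in lborel. (\<lambda>n. V n x) \<longlonglongrightarrow> W x"
    by (rule AE_mp) (simp add: LIM_zero_iff)
  have "lambda1 \<alpha> p \<Omega> * Lp_mass p UNIV W \<le> liminf (\<lambda>n. lambda1 \<alpha> p \<Omega> * Lp_mass p UNIV (V n))"
    using p by (intro mult_Lp_mass_le_liminf[OF fin _ _ lim]) auto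
  also have "\<dots> \<le> liminf (\<lambda>n. E)"
    using order_trans[OF lambda1_mult_Lp_mass_le[OF V] EV]
    by (intro Liminf_mono always_eventually allI)
  finally show ?thesis
    by (simp add: E_def Liminf_const)
qed simp

subsection \<open>Finiteness of the energy of test functions\<close>

text \<open>On the shell between radii d(k+1) and d(k+2) the integrand is at most its value at the
  inner radius, and the shell is estimated by the whole outer ball. This leaves terms of order (k+1)
  powr (n - \<beta>), summable because \<beta> - n > n \<ge> 1.\<close>

lemma nn_integral_norm_powr_far_finite:
  fixes \<beta> d :: real
  assumes \<beta>: "2 * real DIM('a::euclidean_space) < \<beta>" and d: "d > 0"
  shows "(\<integral>\<^sup>+h. ennreal (indicator {h::'a. d \<le> norm h} h / norm h powr \<beta>) \<partial>lborel) < top"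
proof -
  let ?n = "real DIM('a)"
  define V where "V = measure lborel (ball (0::'a) 1)"
  \<comment> \<open>The factor 2 comes from k + 2 \<le> 2(k + 1).\<close>
  define a where "a k = V * (2 * d) ^ DIM('a) * d powr (- \<beta>) * real (Suc k) powr (?n - \<beta>)" for k
  have n1: "?n \<ge> 1"
    using DIM_positive[where 'a='a] by linarith
  then have "summable (\<lambda>k. real (Suc k) powr (?n - \<beta>))"
    unfolding summable_Suc_iff[where f = "\<lambda>k. real k powr (?n - \<beta>)"] summable_real_powr_iff using \<beta> by linarith
  then have sa: "summable a"
    unfolding a_def by (rule summable_mult)
  have a0: "0 \<le> a k" for k
    unfolding a_def V_def using d by simp
  have le: "ennreal (indicator {h::'a. d \<le> norm h} h / norm h powr \<beta>)
     \<le> (\<Sum>k. ennreal ((d * real (Suc k)) powr (- \<beta>)) * indicator (ball (0::'a) (d * real (k + 2))) h)" for h :: 'a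
  proof (cases "d \<le> norm h")
    case True
    \<comment> \<open>\<open>m\<close> is the number of the shell containing h; it is at least 1
      since d \<le> norm h, and k = m - 1 is the summand that dominates.\<close>
    define m where "m = nat \<lfloor>norm h / d\<rfloor>"
    have m: "real m \<le> norm h / d" "norm h / d < real m + 1"
      using d by (auto simp: m_def)
    have "m \<noteq> 0"
      using m(2) True d by (intro notI) (simp add: field_simps)
    then obtain k where k: "m = Suc k" by (cases m) auto
    have b: "d * real (Suc k) \<le> norm h" "norm h < d * real (k + 2)"
      using m d unfolding k by (simp_all add: field_simps)
    have "norm h powr (- \<beta>) \<le> (d * real (Suc k)) powr (- \<beta>)"
      using b(1) d \<beta> n1 by (intro powr_mono2') auto
    then have "ennreal (indicator {h::'a. d \<le> norm h} h / norm h powr \<beta>)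
        \<le> ennreal ((d * real (Suc k)) powr (- \<beta>)) * indicator (ball (0::'a) (d * real (k + 2))) h"
      using True b by (simp add: powr_minus divide_simps ennreal_leI)
    also have "\<dots> \<le> (\<Sum>k. ennreal ((d * real (Suc k)) powr (- \<beta>)) * indicator (ball (0::'a) (d * real (k + 2))) h)"
      by (rule ennreal_le_suminf)
    finally show ?thesis .
  qed simp
  have term_le: "ennreal ((d * real (Suc k)) powr (- \<beta>)) * emeasure lborel (ball (0::'a) (d * real (k + 2)))
      \<le> ennreal (a k)" for k
  proof -
    have "emeasure lborel (ball (0::'a) (d * real (k + 2))) = ennreal (measure lborel (ball (0::'a) (d * real (k + 2))))"
      by (rule emeasure_eq_ennreal_measure) (metis emeasure_lborel_ball_finite infinity_ennreal_def less_irrefl)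
    also have "\<dots> = ennreal ((d * real (k + 2)) ^ DIM('a) * V)"
      using content_ball_conv_unit_ball[of "d * real (k + 2)" "0::'a"] d unfolding V_def by simp
    also have "\<dots> \<le> ennreal ((2 * d * real (Suc k)) ^ DIM('a) * V)"
      using d by (intro ennreal_leI mult_right_mono power_mono) (auto simp: V_def)
    finally have "ennreal ((d * real (Suc k)) powr (- \<beta>)) * emeasure lborel (ball (0::'a) (d * real (k + 2)))
        \<le> ennreal ((d * real (Suc k)) powr (- \<beta>)) * ennreal ((2 * d * real (Suc k)) ^ DIM('a) * V)"
      by (rule mult_left_mono) simp
    also have "\<dots> = ennreal (a k)"
    proof -
      have "(d * real (Suc k)) powr (- \<beta>) * ((2 * d * real (Suc k)) ^ DIM('a) * V) = a k"
      proof -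
        have "real (Suc k) powr (?n - \<beta>) = real (Suc k) ^ DIM('a) * real (Suc k) powr (- \<beta>)"
          by (simp add: powr_diff powr_minus powr_realpow divide_inverse del: of_nat_Suc)
        moreover have "(d * real (Suc k)) powr (- \<beta>) = d powr (- \<beta>) * real (Suc k) powr (- \<beta>)"
          using d by (simp add: powr_mult del: of_nat_Suc)
        ultimately show ?thesis
          by (simp add: a_def power_mult_distrib del: of_nat_Suc)
      qed
      moreover have "0 \<le> V" by (simp add: V_def)
      ultimately show ?thesis using d by (simp flip: ennreal_mult)
    qed
    finally show ?thesis .
  qed
  have "(\<integral>\<^sup>+h. ennreal (indicator {h::'a. d \<le> norm h} h / norm h powr \<beta>) \<partial>lborel)
      \<le> (\<integral>\<^sup>+h. (\<Sum>k. ennreal ((d * real (Suc k)) powr (- \<beta>)) * indicator (ball (0::'a) (d * real (k + 2))) h) \<partial>lborel)"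
    by (intro nn_integral_mono le)
  also have "\<dots> = (\<Sum>k. ennreal ((d * real (Suc k)) powr (- \<beta>)) * emeasure lborel (ball (0::'a) (d * real (k + 2))))"
  proof -
    have A: "ball (0::'a) r \<in> sets lborel" for r by simp
    have "(\<integral>\<^sup>+h. (\<Sum>k. c k * indicator (ball (0::'a) (r k)) h) \<partial>lborel)
        = (\<Sum>k. c k * emeasure lborel (ball (0::'a) (r k)))" for c r
      using A
      by (subst nn_integral_suminf)
         (auto simp: nn_integral_cmult_indicator intro!: borel_measurable_times_ennreal borel_measurable_indicator)
    then show ?thesis .
  qed
  also have "\<dots> \<le> (\<Sum>k. ennreal (a k))"
    by (intro suminf_le term_le) auto
  also have "\<dots> = ennreal (\<Sum>k. a k)"
    using sa a0 by (intro suminf_ennreal2) auto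
  also have "\<dots> < top" by simp
  finally show ?thesis .
qed

section \<open>The energy density as a function on the product space\<close>

definition diff_quot :: "real \<Rightarrow> real \<Rightarrow> ('a::euclidean_space \<Rightarrow> real) \<Rightarrow> 'a \<times> 'a \<Rightarrow> ennreal" where
  "diff_quot p \<beta> f z = ennreal (\<bar>f (fst z) - f (snd z)\<bar> powr p / norm (fst z - snd z) powr \<beta>)"

lemma borel_measurable_diff_quot [measurable]:
  assumes [measurable]: "f \<in> borel_measurable borel"
  shows "diff_quot p \<beta> f \<in> borel_measurable (lborel \<Otimes>\<^sub>M lborel)"
  unfolding diff_quot_def[abs_def] by measurable

text \<open>By Tonelli's theorem the iterated integral becomes a single one, to which dominated
  convergence and almost everywhere arguments on pairs apply.\<close>

lemma frac_energy_eq_diff_quot: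
  fixes f :: "'a::euclidean_space \<Rightarrow> real"
  assumes [measurable]: "f \<in> borel_measurable borel" "S \<in> sets borel"
  shows "frac_energy p \<beta> S f =
    (\<integral>\<^sup>+z. diff_quot p \<beta> f z * indicator (S \<times> S) z \<partial>(lborel \<Otimes>\<^sub>M lborel))"
proof -
  have "frac_energy p \<beta> S f =
      (\<integral>\<^sup>+y. (\<integral>\<^sup>+x. diff_quot p \<beta> f (y, x) * indicator (S \<times> S) (y, x) \<partial>lborel) \<partial>lborel)"
    unfolding frac_energy_def
    by (subst nn_integral_multc[symmetric])
       (auto simp: diff_quot_def indicator_def intro!: nn_integral_cong)
  also have "\<dots> = (\<integral>\<^sup>+z. diff_quot p \<beta> f z * indicator (S \<times> S) z \<partial>(lborel \<Otimes>\<^sub>M lborel))"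
    by (subst lborel.nn_integral_fst[symmetric]) auto
  finally show ?thesis .
qed

text \<open>Write v = u - (u - v). With a test function as \<open>v\<close>, its density is
  controlled by that of the limit \<open>u\<close> and that of the error.\<close>

lemma diff_quot_le:
  assumes p: "p \<ge> 2"
  shows "diff_quot p \<beta> v z \<le> ennreal (2 powr p) * (diff_quot p \<beta> u z + diff_quot p \<beta> (\<lambda>x. u x - v x) z)"
proof -
  obtain y x where z: "z = (y, x)" by (cases z)
  have "\<bar>v y - v x\<bar> powr p \<le> 2 powr p * (\<bar>u y - u x\<bar> powr p + \<bar>(u y - v y) - (u x - v x)\<bar> powr p)"
    using abs_add_powr_le[OF p, of "u y - u x" "(u x - v x) - (u y - v y)"]
      abs_minus_commute[of "u x - v x" "u y - v y"] by simp
  then have "\<bar>v y - v x\<bar> powr p / norm (y - x) powr \<beta>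
      \<le> 2 powr p * (\<bar>u y - u x\<bar> powr p + \<bar>(u y - v y) - (u x - v x)\<bar> powr p) / norm (y - x) powr \<beta>"
    by (rule divide_right_mono) simp
  then show ?thesis
    unfolding diff_quot_def z
    by (simp flip: ennreal_mult ennreal_plus add: ennreal_leI add_divide_distrib distrib_left)
qed

lemma frac_energy_diff_le:
  fixes u v :: "'a::euclidean_space \<Rightarrow> real"
  assumes p: "p \<ge> 2" and [measurable]: "u \<in> borel_measurable borel" "v \<in> borel_measurable borel" "S \<in> sets borel"
  shows "frac_energy p \<beta> S v \<le> ennreal (2 powr p) * (frac_energy p \<beta> S u + frac_energy p \<beta> S (\<lambda>x. u x - v x))"
proof -
  have "frac_energy p \<beta> S v \<le> (\<integral>\<^sup>+z. ennreal (2 powr p) * (diff_quot p \<beta> u z * indicator (S \<times> S) z +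
      diff_quot p \<beta> (\<lambda>x. u x - v x) z * indicator (S \<times> S) z) \<partial>(lborel \<Otimes>\<^sub>M lborel))"
    by (subst frac_energy_eq_diff_quot, simp, simp, intro nn_integral_mono)
       (use diff_quot_le[OF p] in \<open>auto simp: indicator_def\<close>)
  also have "\<dots> = ennreal (2 powr p) * (frac_energy p \<beta> S u + frac_energy p \<beta> S (\<lambda>x. u x - v x))"
    by (simp add: frac_energy_eq_diff_quot nn_integral_cmult nn_integral_add)
  finally show ?thesis .
qed

text \<open>Off \<Omega> \<times> \<Omega> the density vanishes unless one point lies in the support
  \<open>K\<close> and the other outside \<Omega>. Such points are at least \<open>d\<close> apart,
  so the density is bounded by B powr p times the far kernel, which is integrable over
  \<open>K\<close> times the space.\<close>

lemma frac_energy_UNIV_finite: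
  fixes \<phi> :: "'a::euclidean_space \<Rightarrow> real"
  assumes p: "p \<ge> 2" and \<beta>: "2 * real DIM('a) < \<beta>" and \<Omega>: "open \<Omega>"
    and \<phi>: "\<phi> \<in> smooth_compact_support \<Omega>" and fin: "frac_energy p \<beta> \<Omega> \<phi> < top"
  shows "frac_energy p \<beta> UNIV \<phi> < top"
proof -
  define K where "K = closure {x. \<phi> x \<noteq> 0}"
  have K: "compact K" "K \<subseteq> \<Omega>" "\<And>x. \<phi> x \<noteq> 0 \<Longrightarrow> x \<in> K" and c: "continuous_on UNIV \<phi>"
    using \<phi> closure_subset[of "{x. \<phi> x \<noteq> 0}"] by (auto simp: smooth_compact_support_def K_def intro: Ck_imp_continuous)
  have [measurable]: "\<phi> \<in> borel_measurable borel" "\<Omega> \<in> sets borel" "K \<in> sets borel"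
    using c \<Omega> K(1) by (auto intro: borel_measurable_continuous_onI borel_compact)
  obtain B where B: "B > 0" "\<And>x. \<bar>\<phi> x\<bar> \<le> B"
    using bounded_of_compact_support[OF c K(1,3)] by blast
  obtain d where d: "d > 0" "\<And>x y. x \<in> K \<Longrightarrow> y \<notin> \<Omega> \<Longrightarrow> d \<le> norm (x - y)"
    using compact_in_open_margin[OF K(1) \<Omega> K(2)] by blast
  define F where "F h = ennreal (indicator {h::'a. d \<le> norm h} h / norm h powr \<beta>)" for h :: 'a
  have F [measurable]: "F \<in> borel_measurable borel"
    unfolding F_def by measurable
  define J where "J = (\<integral>\<^sup>+h. F h \<partial>lborel)"
  have J: "J < top"
    unfolding J_def F_def by (rule nn_integral_norm_powr_far_finite[OF \<beta> d(1)])
  define G where "G y x = ennreal (\<bar>\<phi> y - \<phi> x\<bar> powr p / norm (y - x) powr \<beta>)" for y x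
  have [measurable]: "(\<lambda>z. G (fst z) (snd z)) \<in> borel_measurable (borel \<Otimes>\<^sub>M borel)"
    unfolding G_def by measurable
  have mG [measurable]: "G y \<in> borel_measurable borel" for y
    unfolding G_def by measurable
  have le: "G y x \<le> G y x * indicator \<Omega> x * indicator \<Omega> y +
      (ennreal (B powr p) * (indicator K y * F (y - x)) + ennreal (B powr p) * (indicator K x * F (y - x)))" for x y
  proof -
    have far: "G y x \<le> ennreal (B powr p) * F (y - x)" if "d \<le> norm (y - x)" "\<bar>\<phi> y - \<phi> x\<bar> \<le> B"
    proof -
      have "\<bar>\<phi> y - \<phi> x\<bar> powr p / norm (y - x) powr \<beta> \<le> B powr p * (1 / norm (y - x) powr \<beta>)"
        using that(2) p by (auto intro!: divide_right_mono powr_mono2)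
      then show ?thesis
        unfolding G_def F_def using that(1) by (simp flip: ennreal_mult add: ennreal_leI)
    qed
    consider "x \<in> \<Omega>" "y \<in> \<Omega>" | "\<phi> x = 0" "\<phi> y = 0" | "x \<notin> \<Omega>" "y \<in> K" | "y \<notin> \<Omega>" "x \<in> K"
      using K(2,3) by blast
    then show ?thesis
    proof cases
      case 3
      then have "\<phi> x = 0" using K(2,3) by blast
      with 3 far d(2)[of y x] B(2)[of y] show ?thesis by (auto intro: add_increasing2)
    next
      case 4
      then have "\<phi> y = 0" using K(2,3) by blast
      with 4 far d(2)[of x y] B(2)[of x] show ?thesis by (auto simp: norm_minus_commute intro: add_increasing)
    qed (auto simp: G_def)
  qed
  have E: "frac_energy p \<beta> \<Omega> \<phi> = (\<integral>\<^sup>+y. (\<integral>\<^sup>+x. G y x * indicator \<Omega> x * indicator \<Omega> y \<partial>lborel) \<partial>lborel)"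
    unfolding frac_energy_def G_def by (subst nn_integral_multc) auto
  have J1: "(\<integral>\<^sup>+y. (\<integral>\<^sup>+x. indicator K y * F (y - x) \<partial>lborel) \<partial>lborel) = emeasure lborel K * J"
    by (simp add: nn_integral_cmult nn_integral_lborel_reflect nn_integral_multc flip: J_def)
  \<comment> \<open>The order is exchanged so that the indicator depends on the outer variable and
    the inner integral is \<open>J\<close> by translation.\<close>
  have "(\<integral>\<^sup>+y. (\<integral>\<^sup>+x. indicator K x * F (y - x) \<partial>lborel) \<partial>lborel)
      = (\<integral>\<^sup>+x. (\<integral>\<^sup>+y. indicator K x * F (y - x) \<partial>lborel) \<partial>lborel)"
    by (intro lborel_pair.Fubini') measurable
  then have J2: "(\<integral>\<^sup>+y. (\<integral>\<^sup>+x. indicator K x * F (y - x) \<partial>lborel) \<partial>lborel) = emeasure lborel K * J"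
    by (simp add: nn_integral_cmult nn_integral_lborel_translate nn_integral_multc flip: J_def)
  have "frac_energy p \<beta> UNIV \<phi> \<le> (\<integral>\<^sup>+y. (\<integral>\<^sup>+x. G y x * indicator \<Omega> x * indicator \<Omega> y +
      (ennreal (B powr p) * (indicator K y * F (y - x)) + ennreal (B powr p) * (indicator K x * F (y - x))) \<partial>lborel) \<partial>lborel)"
    unfolding frac_energy_UNIV G_def[symmetric] by (intro nn_integral_mono le)
  also have "\<dots> = (\<integral>\<^sup>+y. (\<integral>\<^sup>+x. G y x * indicator \<Omega> x * indicator \<Omega> y \<partial>lborel) \<partial>lborel) +
      (ennreal (B powr p) * (\<integral>\<^sup>+y. (\<integral>\<^sup>+x. indicator K y * F (y - x) \<partial>lborel) \<partial>lborel) +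
       ennreal (B powr p) * (\<integral>\<^sup>+y. (\<integral>\<^sup>+x. indicator K x * F (y - x) \<partial>lborel) \<partial>lborel))"
    by (simp add: nn_integral_cmult nn_integral_add)
  also have "\<dots> = frac_energy p \<beta> \<Omega> \<phi> +
      (ennreal (B powr p) * (emeasure lborel K * J) + ennreal (B powr p) * (emeasure lborel K * J))"
    by (simp only: E J1 J2)
  also have "\<dots> < top"
    using fin J emeasure_compact_finite[OF K(1)] by (simp add: ennreal_mult_less_top)
  finally show ?thesis .
qed

subsection \<open>Uniqueness\<close>

text \<open>The rate is chosen summable: this yields both almost everywhere convergence and an
  integrable majorant for the densities.\<close>

lemma frac_sobolev0_fast_approximation:
  fixes u :: "'a::euclidean_space \<Rightarrow> real"
  assumes "u \<in> frac_sobolev0 s p \<Omega>"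
  obtains \<phi> where "\<And>n::nat. \<phi> n \<in> smooth_compact_support \<Omega>"
    "\<And>n. frac_sobolev_norm_pow s p \<Omega> (\<lambda>x. u x - \<phi> n x) < ennreal ((1/2)^n)"
proof -
  have "\<forall>n::nat. \<exists>\<phi>. \<phi> \<in> smooth_compact_support \<Omega> \<and>
      frac_sobolev_norm_pow s p \<Omega> (\<lambda>x. u x - \<phi> x) < ennreal ((1/2)^n)"
    using assms unfolding frac_sobolev0_def by (auto simp: Bex_def)
  from choice[OF this] show ?thesis using that by auto
qed

lemma smooth_compact_supportD:
  assumes "\<phi> \<in> smooth_compact_support \<Omega>"
  shows "\<phi> \<in> borel_measurable borel" "continuous_on UNIV \<phi>" "compact (closure {x. \<phi> x \<noteq> 0})"
    "closure {x. \<phi> x \<noteq> 0} \<subseteq> \<Omega>" "\<And>x. \<phi> x \<noteq> 0 \<Longrightarrow> x \<in> closure {x. \<phi> x \<noteq> 0}"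
    "\<And>x. x \<notin> \<Omega> \<Longrightarrow> \<phi> x = 0"
  using assms closure_subset[of "{x. \<phi> x \<noteq> 0}"] unfolding smooth_compact_support_def
  by (auto intro: Ck_imp_continuous borel_measurable_continuous_onI)

lemma Lp_mass_eq_UNIV:
  assumes "p > 0" "\<And>x. x \<notin> \<Omega> \<Longrightarrow> u x = 0"
  shows "Lp_mass p \<Omega> u = Lp_mass p UNIV u"
  unfolding Lp_mass_def using assms by (intro nn_integral_cong) (auto simp: indicator_def)

text \<open>The norm over \<Omega> controls the mass of the error on the whole space because both
  functions vanish outside \<Omega>.\<close>

lemma AE_tendsto_of_fast_approximation:
  fixes u :: "'a::euclidean_space \<Rightarrow> real"
  assumes p: "p > 0" and [measurable]: "u \<in> borel_measurable borel" and u0: "\<And>x. x \<notin> \<Omega> \<Longrightarrow> u x = 0"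
    and \<phi>: "\<And>n. \<phi> n \<in> smooth_compact_support \<Omega>"
    and fast: "\<And>n. frac_sobolev_norm_pow s p \<Omega> (\<lambda>x. u x - \<phi> n x) < ennreal ((1/2)^n)"
  shows "AE x in lborel. (\<lambda>n. \<phi> n x) \<longlonglongrightarrow> u x"
proof -
  have [measurable]: "\<phi> n \<in> borel_measurable borel" for n
    by (rule smooth_compact_supportD[OF \<phi>])
  have "AE x in lborel. (\<lambda>n. u x - \<phi> n x) \<longlonglongrightarrow> 0"
  proof (rule AE_tendsto_0_of_suminf_powr)
    have le: "(\<integral>\<^sup>+x. ennreal (\<bar>u x - \<phi> n x\<bar> powr p) \<partial>lborel) \<le> ennreal ((1/2)^n)" for n
    proof -
      have "Lp_mass p UNIV (\<lambda>x. u x - \<phi> n x) = Lp_mass p \<Omega> (\<lambda>x. u x - \<phi> n x)"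
        using u0 smooth_compact_supportD(6)[OF \<phi>] by (intro Lp_mass_eq_UNIV[symmetric] p) simp
      also have "\<dots> \<le> frac_sobolev_norm_pow s p \<Omega> (\<lambda>x. u x - \<phi> n x)"
        by (simp add: frac_sobolev_norm_pow_def)
      finally show ?thesis using fast[of n] by (simp add: Lp_mass_UNIV)
    qed
    have "(\<Sum>n. \<integral>\<^sup>+x. ennreal (\<bar>u x - \<phi> n x\<bar> powr p) \<partial>lborel) < top"
      using le by (intro suminf_geometric_half_less_top[where E = 1]) simp_all
    then show "(\<Sum>n. \<integral>\<^sup>+x. ennreal (\<bar>u x - \<phi> n x\<bar> powr p) \<partial>lborel) \<noteq> \<infinity>"
      by simp
  qed (use p in auto)
  then show ?thesis
  proof (rule AE_mp, intro AE_I2 impI)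
    fix x assume "(\<lambda>n. u x - \<phi> n x) \<longlonglongrightarrow> 0"
    from tendsto_diff[OF tendsto_const[of "u x"] this] show "(\<lambda>n. \<phi> n x) \<longlonglongrightarrow> u x" by simp
  qed
qed

lemma Lp_mass_test_pos:
  assumes "\<phi> \<in> smooth_compact_support \<Omega>" "\<phi> x0 \<noteq> 0"
  shows "Lp_mass p UNIV \<phi> \<noteq> 0"
proof
  assume "Lp_mass p UNIV \<phi> = 0"
  then have "AE x in lborel. \<phi> x = 0"
    by (rule Lp_mass_eq_0D[OF smooth_compact_supportD(1)[OF assms(1)]])
  from continuous_AE_0_imp_0[OF smooth_compact_supportD(2)[OF assms(1)] this] assms(2)
  show False by blast
qed

section \<open>Minimizers and the comparison function \<open>w\<close>\<close>

context
  fixes \<Omega> :: "'a::euclidean_space set" and \<alpha> s p :: real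
  assumes \<Omega>: "open \<Omega>" and p: "p \<ge> 2" and \<beta>: "2 * real DIM('a) < \<alpha> * p"
    and s: "s = \<alpha> - real DIM('a) / p"
begin

lemma sobolev_exponent: "real DIM('a) + s * p = \<alpha> * p"
  using p by (simp add: s field_simps)

text \<open>The mass is neither 0 nor infinite, so the equation for the quotient can be cleared of
  its denominator. Finiteness of the energy is obtained here on \<Omega> only; on the whole space it
  has to wait for finiteness of \<open>lambda1\<close>.\<close>

lemma minimizerD:
  assumes "is_minimizer \<alpha> s p \<Omega> u"
  shows "u \<in> borel_measurable borel" "\<And>x. x \<notin> \<Omega> \<Longrightarrow> u x = 0" "frac_energy p (\<alpha> * p) \<Omega> u < top"
    "Lp_mass p UNIV u < top" "Lp_mass p UNIV u \<noteq> 0"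
    "frac_energy p (\<alpha> * p) UNIV u = lambda1 \<alpha> p \<Omega> * Lp_mass p UNIV u"
proof -
  have u: "u \<in> frac_sobolev0 s p \<Omega>" "\<not> (AE x in lborel. u x = 0)" "rayleigh \<alpha> p u = lambda1 \<alpha> p \<Omega>"
    using assms by (auto simp: is_minimizer_def)
  show [measurable]: "u \<in> borel_measurable borel" and u0: "\<And>x. x \<notin> \<Omega> \<Longrightarrow> u x = 0"
    using u(1) by (auto simp: frac_sobolev0_def)
  have "frac_sobolev_norm_pow s p \<Omega> u < top"
    using u(1) by (simp add: frac_sobolev0_def)
  then show "frac_energy p (\<alpha> * p) \<Omega> u < top" and M: "Lp_mass p UNIV u < top"
    using Lp_mass_eq_UNIV[of p \<Omega> u] u0 p
    by (simp_all add: frac_sobolev_norm_pow_def sobolev_exponent)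
  show M0: "Lp_mass p UNIV u \<noteq> 0"
    using Lp_mass_eq_0D[of u p] u(2) by auto
  show "frac_energy p (\<alpha> * p) UNIV u = lambda1 \<alpha> p \<Omega> * Lp_mass p UNIV u"
    unfolding u(3)[symmetric] rayleigh_def using M M0 by (simp add: ennreal_divide_times)
qed

text \<open>If all approximating test functions were zero, their almost everywhere limit
  \<open>u\<close> would be zero too. The energy of a nonzero one over \<Omega> is finite by
  comparison with \<open>u\<close>.\<close>

lemma test_function_exists:
  assumes u: "u \<in> frac_sobolev0 s p \<Omega>" "\<not> (AE x in lborel. u x = 0)"
  obtains \<phi> x0 where "\<phi> \<in> smooth_compact_support \<Omega>" "\<phi> x0 \<noteq> 0" "frac_energy p (\<alpha> * p) \<Omega> \<phi> < top"
proof -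
  have [measurable]: "u \<in> borel_measurable borel" and u0: "\<And>x. x \<notin> \<Omega> \<Longrightarrow> u x = 0"
    and Eu: "frac_energy p (\<alpha> * p) \<Omega> u < top"
    using u(1) by (auto simp: frac_sobolev0_def frac_sobolev_norm_pow_def sobolev_exponent)
  obtain \<phi> where \<phi>: "\<And>n::nat. \<phi> n \<in> smooth_compact_support \<Omega>"
    "\<And>n. frac_sobolev_norm_pow s p \<Omega> (\<lambda>x. u x - \<phi> n x) < ennreal ((1/2)^n)"
    using frac_sobolev0_fast_approximation[OF u(1)] by blast
  have "\<exists>n x0. \<phi> n x0 \<noteq> 0"
  proof (rule ccontr)
    assume "\<not> ?thesis"
    then have "\<phi> n x = 0" for n x by blast
    with AE_tendsto_of_fast_approximation[OF _ _ u0 \<phi>] p have "AE x in lborel. (\<lambda>n. 0) \<longlonglongrightarrow> u x"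
      by simp
    then have "AE x in lborel. u x = 0"
    proof eventually_elim
      case (elim x)
      from LIMSEQ_unique[OF elim tendsto_const] show ?case .
    qed
    with u(2) show False by simp
  qed
  then obtain n x0 where n: "\<phi> n x0 \<noteq> 0" by blast
  have "frac_energy p (\<alpha> * p) \<Omega> (\<lambda>x. u x - \<phi> n x) \<le> frac_sobolev_norm_pow s p \<Omega> (\<lambda>x. u x - \<phi> n x)"
    by (simp add: frac_sobolev_norm_pow_def sobolev_exponent)
  also have "\<dots> < top"
    using \<phi>(2)[of n] by (rule order.strict_trans) simp
  finally have "frac_energy p (\<alpha> * p) \<Omega> (\<phi> n) < top"
    using frac_energy_diff_le[OF p, of u "\<phi> n" \<Omega> "\<alpha> * p"] Eu smooth_compact_supportD(1)[OF \<phi>(1)] \<Omega>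
    by (auto simp: ennreal_mult_less_top intro: le_less_trans)
  with that \<phi>(1) n show ?thesis by blast
qed

text \<open>
  A minimizer only satisfies an equation with \<open>\<lambda>\<^sub>1\<close>, so finiteness of \<open>\<lambda>\<^sub>1\<close> must come from a test function;
  \<open>2n < \<alpha>p\<close> makes the interaction with the complement of \<open>\<Omega>\<close> finite.
\<close>
lemma lambda1_finite:
  assumes "\<phi> \<in> smooth_compact_support \<Omega>" "\<phi> x0 \<noteq> 0" "frac_energy p (\<alpha> * p) \<Omega> \<phi> < top"
  shows "lambda1 \<alpha> p \<Omega> < top"
proof -
  have "lambda1 \<alpha> p \<Omega> \<le> rayleigh \<alpha> p \<phi>"
    unfolding lambda1_def using assms(1,2) by (intro INF_lower) auto
  also have "\<dots> < top"
    using frac_energy_UNIV_finite[OF p \<beta> \<Omega> assms(1,3)] Lp_mass_test_pos[OF assms(1,2), of p]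
    unfolding rayleigh_def less_top[symmetric] by (auto simp: ennreal_divide_eq_top_iff)
  finally show ?thesis .
qed

text \<open>For the truncations \<open>W n\<close> the inequality is known. In the limit the
  energies converge by dominated convergence, while Fatou's lemma suffices for the masses.\<close>

lemma lambda1_mult_Lp_mass_le_pnorm2:
  fixes u v :: "'a \<Rightarrow> real"
  defines "w \<equiv> \<lambda>x. pnorm2 p (u x) (v x)"
  assumes u: "u \<in> frac_sobolev0 s p \<Omega>" "\<not> (AE x in lborel. u x = 0)" and v: "v \<in> frac_sobolev0 s p \<Omega>"
    and Ew: "frac_energy p (\<alpha> * p) UNIV w < top"
  shows "lambda1 \<alpha> p \<Omega> * Lp_mass p UNIV w \<le> frac_energy p (\<alpha> * p) UNIV w"
proof -
  let ?G = "diff_quot p (\<alpha> * p) :: ('a \<Rightarrow> real) \<Rightarrow> _" and ?P = "lborel \<Otimes>\<^sub>M (lborel :: 'a measure)"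
  let ?EO = "frac_energy p (\<alpha> * p) \<Omega>" and ?I = "indicator (\<Omega> \<times> \<Omega>) :: _ \<Rightarrow> ennreal"
  have p0: "p > 0" using p by simp
  have [measurable]: "\<Omega> \<in> sets borel" using \<Omega> by simp
  have um [measurable]: "u \<in> borel_measurable borel" and u0: "\<And>x. x \<notin> \<Omega> \<Longrightarrow> u x = 0" and Eu: "?EO u < top"
    using u(1) by (auto simp: frac_sobolev0_def frac_sobolev_norm_pow_def sobolev_exponent)
  have vm [measurable]: "v \<in> borel_measurable borel" and v0: "\<And>x. x \<notin> \<Omega> \<Longrightarrow> v x = 0" and Ev: "?EO v < top"
    using v by (auto simp: frac_sobolev0_def frac_sobolev_norm_pow_def sobolev_exponent)
  have wm [measurable]: "w \<in> borel_measurable borel"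
    unfolding w_def pnorm2_def by measurable
  obtain \<phi> where \<phi>: "\<And>n::nat. \<phi> n \<in> smooth_compact_support \<Omega>"
    "\<And>n. frac_sobolev_norm_pow s p \<Omega> (\<lambda>x. u x - \<phi> n x) < ennreal ((1/2)^n)"
    using frac_sobolev0_fast_approximation[OF u(1)] by blast
  obtain \<psi> where \<psi>: "\<And>n::nat. \<psi> n \<in> smooth_compact_support \<Omega>"
    "\<And>n. frac_sobolev_norm_pow s p \<Omega> (\<lambda>x. v x - \<psi> n x) < ennreal ((1/2)^n)"
    using frac_sobolev0_fast_approximation[OF v] by blast
  note \<phi>D = smooth_compact_supportD[OF \<phi>(1)] and \<psi>D = smooth_compact_supportD[OF \<psi>(1)]
  have [measurable]: "\<phi> n \<in> borel_measurable borel" "\<psi> n \<in> borel_measurable borel" for n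
    by (rule \<phi>D, rule \<psi>D)
  define \<zeta> where "\<zeta> n x = pnorm2 p (\<phi> n x) (\<psi> n x)" for n x
  \<comment> \<open>The minimum takes boundedness and compact support from \<open>\<zeta> n\<close>,
    and the bound by \<open>w\<close>, hence the control outside \<Omega> \<times> \<Omega>, from
    \<open>w\<close>.\<close>
  define W where "W n x = min (w x) (\<zeta> n x)" for n x
  have [measurable]: "\<zeta> n \<in> borel_measurable borel" for n
    unfolding \<zeta>_def pnorm2_def by measurable
  have Wm [measurable]: "W n \<in> borel_measurable borel" for n
    unfolding W_def by measurable
  have w0: "w x = 0" if "x \<notin> \<Omega>" for x
    using that u0 v0 by (simp add: w_def)
  have W0: "0 \<le> W n x" "W n x \<le> w x" for n x
    by (auto simp: W_def w_def \<zeta>_def)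
  \<comment> \<open>The full series of error densities dominates each single error, which makes the
    majorant independent of n. The indicators confine these terms to \<Omega> \<times> \<Omega>,
    where the norm controls them.\<close>
  define H where "H z = ?G w z + ennreal (2 powr p) * ((?G u z * ?I z + ?G v z * ?I z) +
      ((\<Sum>n. ?G (\<lambda>x. u x - \<phi> n x) z * ?I z) + (\<Sum>n. ?G (\<lambda>x. v x - \<psi> n x) z * ?I z)))" for z
  have Hm [measurable]: "H \<in> borel_measurable ?P"
    unfolding H_def by measurable
  have GH: "?G (W n) z \<le> H z" for n z
  proof -
    obtain y x where z: "z = (y, x)" by (cases z)
    show ?thesis
    proof (cases "z \<in> \<Omega> \<times> \<Omega>")
      case True
      \<comment> \<open>A difference of two minima is bounded by one of the two differences.\<close>
      have "\<bar>W n y - W n x\<bar> \<le> \<bar>w y - w x\<bar> \<or> \<bar>W n y - W n x\<bar> \<le> \<bar>\<zeta> n y - \<zeta> n x\<bar>"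
        by (auto simp: W_def min_def abs_if split: if_splits)
      then have "\<bar>W n y - W n x\<bar> powr p \<le> \<bar>w y - w x\<bar> powr p \<or> \<bar>W n y - W n x\<bar> powr p \<le> \<bar>\<zeta> n y - \<zeta> n x\<bar> powr p"
        using p by (auto intro!: powr_mono2)
      moreover have "0 \<le> \<bar>w y - w x\<bar> powr p" "0 \<le> \<bar>\<phi> n y - \<phi> n x\<bar> powr p + \<bar>\<psi> n y - \<psi> n x\<bar> powr p"
        by simp_all
      ultimately have "\<bar>W n y - W n x\<bar> powr p
          \<le> \<bar>w y - w x\<bar> powr p + (\<bar>\<phi> n y - \<phi> n x\<bar> powr p + \<bar>\<psi> n y - \<psi> n x\<bar> powr p)"
        using pnorm2_diff_powr(1)[OF p, of "\<phi> n y" "\<psi> n y" "\<phi> n x" "\<psi> n x"]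
        unfolding \<zeta>_def by linarith
      from divide_right_mono[OF this, of "norm (y - x) powr (\<alpha> * p)"]
      have "?G (W n) z \<le> ?G w z + (?G (\<phi> n) z + ?G (\<psi> n) z)"
        unfolding diff_quot_def z
        by (simp flip: ennreal_plus add: add_divide_distrib ennreal_leI)
      also have "\<dots> \<le> ?G w z + (ennreal (2 powr p) * (?G u z + ?G (\<lambda>x. u x - \<phi> n x) z) +
          ennreal (2 powr p) * (?G v z + ?G (\<lambda>x. v x - \<psi> n x) z))"
        by (intro add_mono order_refl diff_quot_le[OF p])
      also have "\<dots> = ?G w z + ennreal (2 powr p) * ((?G u z * ?I z + ?G v z * ?I z) +
          (?G (\<lambda>x. u x - \<phi> n x) z * ?I z + ?G (\<lambda>x. v x - \<psi> n x) z * ?I z))"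
        using True by (simp add: distrib_left add_ac)
      also have "\<dots> \<le> H z"
        unfolding H_def by (intro add_mono mult_left_mono order_refl ennreal_le_suminf) simp_all
      finally show ?thesis .
    next
      case False
      \<comment> \<open>Where \<open>w\<close> vanishes, so does \<open>W n\<close>. The difference
        of \<open>W n\<close> is then a single value, bounded by the corresponding value of
        \<open>w\<close>.\<close>
      then have "w x = 0 \<or> w y = 0" using w0 z by auto
      then have "\<bar>W n y - W n x\<bar> \<le> \<bar>w y - w x\<bar>"
        using W0[of n x] W0[of n y] by auto
      then have "?G (W n) z \<le> ?G w z"
        unfolding diff_quot_def z using p by (auto intro!: ennreal_leI divide_right_mono powr_mono2)
      also have "\<dots> \<le> H z" by (simp add: H_def)
      finally show ?thesis .
    qed
  qed
  have Hfin: "(\<integral>\<^sup>+z. H z \<partial>?P) < top"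
  proof -
    have fast: "(\<Sum>n. \<integral>\<^sup>+z. ?G (\<lambda>x. f x - g n x) z * ?I z \<partial>?P) < top"
      if [measurable]: "f \<in> borel_measurable borel" "\<And>n. g n \<in> borel_measurable borel"
        and "\<And>n. frac_sobolev_norm_pow s p \<Omega> (\<lambda>x. f x - g n x) < ennreal ((1/2)^n)" for f g
    proof -
      have "?EO (\<lambda>x. f x - g n x) \<le> ennreal ((1/2)^n)" for n
      proof -
        have "?EO (\<lambda>x. f x - g n x) \<le> frac_sobolev_norm_pow s p \<Omega> (\<lambda>x. f x - g n x)"
          by (simp add: frac_sobolev_norm_pow_def sobolev_exponent)
        with that(3)[of n] show ?thesis by simp
      qed
      then show ?thesis
        by (intro suminf_geometric_half_less_top[where E = 1]) (simp_all flip: frac_energy_eq_diff_quot)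
    qed
    define A where "A z = (\<Sum>n. ?G (\<lambda>x. u x - \<phi> n x) z * ?I z)" for z
    define B where "B z = (\<Sum>n. ?G (\<lambda>x. v x - \<psi> n x) z * ?I z)" for z
    have [measurable]: "A \<in> borel_measurable ?P" "B \<in> borel_measurable ?P"
      unfolding A_def B_def by measurable
    have "(\<integral>\<^sup>+z. H z \<partial>?P) = frac_energy p (\<alpha> * p) UNIV w + ennreal (2 powr p) * ((?EO u + ?EO v) +
        ((\<integral>\<^sup>+z. A z \<partial>?P) + (\<integral>\<^sup>+z. B z \<partial>?P)))"
      unfolding H_def A_def[symmetric] B_def[symmetric]
      by (simp add: nn_integral_add nn_integral_cmult frac_energy_eq_diff_quot)
    moreover have "(\<integral>\<^sup>+z. A z \<partial>?P) = (\<Sum>n. \<integral>\<^sup>+z. ?G (\<lambda>x. u x - \<phi> n x) z * ?I z \<partial>?P)"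
      unfolding A_def by (rule nn_integral_suminf) measurable
    moreover have "(\<integral>\<^sup>+z. B z \<partial>?P) = (\<Sum>n. \<integral>\<^sup>+z. ?G (\<lambda>x. v x - \<psi> n x) z * ?I z \<partial>?P)"
      unfolding B_def by (rule nn_integral_suminf) measurable
    ultimately show ?thesis
      using Ew Eu Ev fast[OF um _ \<phi>(2)] fast[OF vm _ \<psi>(2)] by (simp add: ennreal_mult_less_top)
  qed
  have "AE x in lborel. (\<lambda>n. \<phi> n x) \<longlonglongrightarrow> u x"
    by (rule AE_tendsto_of_fast_approximation[OF p0 um u0 \<phi>])
  moreover have "AE x in lborel. (\<lambda>n. \<psi> n x) \<longlonglongrightarrow> v x"
    by (rule AE_tendsto_of_fast_approximation[OF p0 vm v0 \<psi>])
  ultimately have limW: "AE x in lborel. (\<lambda>n. W n x) \<longlonglongrightarrow> w x"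
  proof eventually_elim
    case (elim x)
    have "(\<lambda>n. \<zeta> n x) \<longlonglongrightarrow> w x"
      using continuous_on_tendsto_compose[OF continuous_pnorm2[OF p0] tendsto_Pair[OF elim]]
      by (simp add: \<zeta>_def w_def)
    from tendsto_min[OF tendsto_const[of "w x"] this] show ?case
      by (simp add: W_def)
  qed
  have "(\<lambda>n. \<integral>\<^sup>+z. ?G (W n) z \<partial>?P) \<longlonglongrightarrow> (\<integral>\<^sup>+z. ?G w z \<partial>?P)"
  proof (rule nn_integral_dominated_convergence[where w = H])
    show "AE z in ?P. (\<lambda>n. ?G (W n) z) \<longlonglongrightarrow> ?G w z"
    proof -
      \<comment> \<open>A measurable null set \<open>N\<close> covering the exceptional points makes
        the condition on pairs measurable, so that it can be checked section by section.\<close>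
      obtain N where N: "{x \<in> space lborel. \<not> (\<lambda>n. W n x) \<longlonglongrightarrow> w x} \<subseteq> N" "N \<in> null_sets lborel"
        using limW unfolding eventually_ae_filter by blast
      from N(2) have [measurable]: "N \<in> sets borel" by auto
      have notN: "AE x in lborel. x \<notin> N"
        by (rule AE_not_in[OF N(2)])
      have "AE z in ?P. fst z \<notin> N \<and> snd z \<notin> N"
      proof (rule lborel_pair.AE_pair_measure)
        show "{z \<in> space ?P. fst z \<notin> N \<and> snd z \<notin> N} \<in> sets ?P"
          by measurable
        show "AE y in lborel. AE x in lborel. fst (y, x) \<notin> N \<and> snd (y, x) \<notin> N"
          using notN by (rule AE_mp) (use notN in simp)
      qed
      then show ?thesis
      proof eventually_elim
        case (elim z)
        then have "(\<lambda>n. W n (fst z)) \<longlonglongrightarrow> w (fst z)" "(\<lambda>n. W n (snd z)) \<longlonglongrightarrow> w (snd z)"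
          using N(1) by auto
        then show ?case
          unfolding diff_quot_def divide_inverse using p0
          by (intro tendsto_ennrealI tendsto_mult tendsto_powr' tendsto_rabs tendsto_diff tendsto_const) auto
      qed
    qed
    show "AE z in ?P. ?G (W n) z \<le> H z" for n
      using GH by simp
  qed (use Hfin in simp_all)
  then have limE: "(\<lambda>n. frac_energy p (\<alpha> * p) UNIV (W n)) \<longlonglongrightarrow> frac_energy p (\<alpha> * p) UNIV w"
    by (simp add: frac_energy_eq_diff_quot)
  obtain \<theta> x0 where \<theta>: "\<theta> \<in> smooth_compact_support \<Omega>" "\<theta> x0 \<noteq> 0" "?EO \<theta> < top"
    using test_function_exists[OF u] by blast
  have fin: "lambda1 \<alpha> p \<Omega> < top"
    using \<theta> by (rule lambda1_finite)
  have le: "lambda1 \<alpha> p \<Omega> * Lp_mass p UNIV (W n) \<le> frac_energy p (\<alpha> * p) UNIV (W n)" for n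
  proof -
    let ?K = "closure {x. \<phi> n x \<noteq> 0} \<union> closure {x. \<psi> n x \<noteq> 0}"
    have K: "compact ?K" "?K \<subseteq> \<Omega>"
      using \<phi>D(3,4) \<psi>D(3,4) by (auto intro: compact_Un)
    have \<zeta>K: "x \<in> ?K" if "\<zeta> n x \<noteq> 0" for x
      using that \<phi>D(5)[of n x] \<psi>D(5)[of n x] by (auto simp: \<zeta>_def)
    have "continuous_on UNIV (\<zeta> n)"
      unfolding \<zeta>_def using continuous_on_compose2[OF continuous_pnorm2[OF p0] continuous_on_Pair[OF \<phi>D(2) \<psi>D(2)]]
      by simp
    from bounded_of_compact_support[OF this K(1) \<zeta>K] obtain B where B: "\<And>x. \<bar>\<zeta> n x\<bar> \<le> B"
      by metis
    have "\<bar>W n x\<bar> \<le> B" for x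
      using B[of x] W0(1)[of n x] by (simp add: W_def)
    moreover have "x \<in> ?K" if "W n x \<noteq> 0" for x
    proof (rule \<zeta>K)
      have "0 \<le> w x" by (simp add: w_def)
      then show "\<zeta> n x \<noteq> 0"
        using that by (auto simp: W_def)
    qed
    moreover have "real DIM('a) < \<alpha> * p" using \<beta> by linarith
    ultimately show ?thesis
      using lambda1_mult_Lp_mass_le_of_compact_support[OF p _ \<Omega> \<theta>(1,2) Wm _ K _ fin] by blast
  qed
  have "lambda1 \<alpha> p \<Omega> * Lp_mass p UNIV w \<le> liminf (\<lambda>n. lambda1 \<alpha> p \<Omega> * Lp_mass p UNIV (W n))"
    by (rule mult_Lp_mass_le_liminf[OF fin p0 Wm limW])
  also have "\<dots> \<le> liminf (\<lambda>n. frac_energy p (\<alpha> * p) UNIV (W n))"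
    using le by (intro Liminf_mono always_eventually allI)
  also have "\<dots> = frac_energy p (\<alpha> * p) UNIV w"
    using limE by (intro lim_imp_Liminf) simp_all
  finally show ?thesis .
qed

text \<open>The energies of \<open>u\<close> and \<open>v\<close> add up to \<open>lambda1\<close>
  times the mass of \<open>w\<close>, which is at most the energy of \<open>w\<close>; the pointwise
  comparison gives the reverse inequality. Hence the densities agree almost everywhere, and the
  equality case applies.\<close>

lemma minimizer_unique:
  assumes u: "is_minimizer \<alpha> s p \<Omega> u" and v: "is_minimizer \<alpha> s p \<Omega> v"
  shows "\<exists>C. AE x in lborel. u x = C * v x"
proof -
  define w where "w x = pnorm2 p (u x) (v x)" for x
  let ?L = "lambda1 \<alpha> p \<Omega>" and ?E = "frac_energy p (\<alpha> * p) UNIV" and ?M = "Lp_mass p UNIV"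
  note [measurable] = minimizerD(1)[OF u] minimizerD(1)[OF v]
  have mw [measurable]: "w \<in> borel_measurable borel"
    unfolding w_def[abs_def] pnorm2_def by measurable
  have us: "u \<in> frac_sobolev0 s p \<Omega>" "\<not> (AE x in lborel. u x = 0)" and vs: "v \<in> frac_sobolev0 s p \<Omega>"
    using u v by (auto simp: is_minimizer_def)
  obtain \<phi> x0 where "\<phi> \<in> smooth_compact_support \<Omega>" "\<phi> x0 \<noteq> 0" "frac_energy p (\<alpha> * p) \<Omega> \<phi> < top"
    using test_function_exists[OF us] .
  then have L: "?L < top" by (rule lambda1_finite)
  have Efin: "?E u < top" "?E v < top"
    using L minimizerD(4)[OF u] minimizerD(4)[OF v] by (simp_all add: minimizerD(6)[OF u] minimizerD(6)[OF v] ennreal_mult_less_top)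
  define G where "G = (diff_quot p (\<alpha> * p) :: ('a \<Rightarrow> real) \<Rightarrow> _)"
  have EG: "?E f = (\<integral>\<^sup>+z. G f z \<partial>(lborel \<Otimes>\<^sub>M lborel))" if "f \<in> borel_measurable borel" for f
    using frac_energy_eq_diff_quot[OF that, of UNIV] by (simp add: G_def)
  have mG [measurable]: "G f \<in> borel_measurable (lborel \<Otimes>\<^sub>M lborel)" if "f \<in> borel_measurable borel" for f
    using that by (simp add: G_def borel_measurable_diff_quot)
  have le: "G w z \<le> G u z + G v z" for z
    using pnorm2_diff_powr(1)[OF p, of "u (fst z)" "v (fst z)" "u (snd z)" "v (snd z)"]
    by (auto simp: G_def diff_quot_def w_def simp flip: ennreal_plus add_divide_distrib intro!: ennreal_leI divide_right_mono)
  have Mw: "?M w = ?M u + ?M v"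
    unfolding Lp_mass_UNIV w_def using p by (subst nn_integral_add[symmetric]) (auto simp: pnorm2_powr)
  have "?E w \<le> ?E u + ?E v"
    using le by (simp add: EG nn_integral_mono flip: nn_integral_add)
  moreover from this have Ewfin: "?E w < top"
    using Efin by (auto intro: le_less_trans)
  have "?E u + ?E v \<le> ?E w"
    using lambda1_mult_Lp_mass_le_pnorm2[OF us vs] Ewfin
    by (simp add: minimizerD(6)[OF u] minimizerD(6)[OF v] Mw distrib_left flip: w_def[abs_def])
  ultimately have Eeq: "?E u + ?E v = ?E w" by (rule antisym[rotated])
  \<comment> \<open>Subtraction is legitimate because the energy of \<open>w\<close> is finite and
    \<open>le\<close> makes the difference of densities a true one; a nonnegative function with zero
    integral vanishes almost everywhere.\<close>
  have "(\<integral>\<^sup>+z. (G u z + G v z) - G w z \<partial>(lborel \<Otimes>\<^sub>M lborel)) = (?E u + ?E v) - ?E w"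
    using Ewfin le by (subst nn_integral_diff) (auto simp: EG nn_integral_add)
  also have "\<dots> = 0"
    using Efin unfolding Eeq[symmetric] by (intro diff_eq_0_ennreal) simp_all
  finally have "AE z in lborel \<Otimes>\<^sub>M lborel. (G u z + G v z) - G w z = 0"
    by (subst (asm) nn_integral_0_iff_AE) auto
  then have "AE z in lborel \<Otimes>\<^sub>M lborel. u (fst z) * v (snd z) = u (snd z) * v (fst z)"
  proof (rule AE_mp, intro AE_I2 impI)
    fix z :: "'a \<times> 'a"
    assume *: "(G u z + G v z) - G w z = 0"
    obtain y x where z: "z = (y, x)" by (cases z)
    show "u (fst z) * v (snd z) = u (snd z) * v (fst z)"
    \<comment> \<open>Off the diagonal the kernel is nonzero and cancels; on it the claimed identity
      is trivial.\<close>
    proof (cases "y = x")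
      case False
      have "G u z + G v z \<noteq> top"
        by (simp add: G_def diff_quot_def)
      then have "G u z + G v z = G w z"
        using * le[of z] by (simp add: ennreal_minus_eq_0 antisym)
      then have "(\<bar>u y - u x\<bar> powr p + \<bar>v y - v x\<bar> powr p) / norm (y - x) powr (\<alpha> * p)
          = \<bar>w y - w x\<bar> powr p / norm (y - x) powr (\<alpha> * p)"
        by (simp add: G_def diff_quot_def z add_divide_distrib flip: ennreal_plus)
      then have "\<bar>w y - w x\<bar> powr p = \<bar>u y - u x\<bar> powr p + \<bar>v y - v x\<bar> powr p"
        using False by simp
      then show ?thesis
        using pnorm2_diff_powr(2)[OF p] unfolding w_def by (simp add: z)
    qed (simp add: z)
  qed
  from lborel_pair.AE_pair[OF this]
  have par: "AE y in lborel. AE x in lborel. u y * v x = u x * v y"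
    by simp
  \<comment> \<open>Almost every y is admissible in \<open>par\<close>, and \<open>v\<close> is not
    zero almost everywhere, so some admissible y has v y \<noteq> 0. It fixes the constant C = u y /
    v y.\<close>
  have "\<exists>y. v y \<noteq> 0 \<and> (AE x in lborel. u y * v x = u x * v y)"
  proof (rule ccontr)
    assume "\<not> ?thesis"
    with par have "AE y in lborel. v y = 0"
      by (auto elim: eventually_mono)
    with v show False by (simp add: is_minimizer_def)
  qed
  then obtain y where y: "v y \<noteq> 0" "AE x in lborel. u y * v x = u x * v y"
    by blast
  from y(2) have "AE x in lborel. u x = (u y / v y) * v x"
    by (rule AE_mp) (use y(1) in \<open>auto simp: field_simps\<close>)
  then show ?thesis ..
qed

end

theorem theorem14:
  fixes \<Omega> :: "'a::euclidean_space set" and \<alpha> s p :: real and u v :: "'a \<Rightarrow> real"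
  assumes "open \<Omega>" and "connected \<Omega>" and "\<Omega> \<noteq> {}" and "bounded \<Omega>"
    and "p \<ge> 2"
    and "2 * real DIM('a) < \<alpha> * p" and "\<alpha> * p < real DIM('a) + p"
    and "s = \<alpha> - real DIM('a) / p"
    and "is_minimizer \<alpha> s p \<Omega> u" and "is_minimizer \<alpha> s p \<Omega> v"
  shows "\<exists>C. AE x in lborel. u x = C * v x"
  using minimizer_unique[OF assms(1,5,6,8,9,10)] .

end
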